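(* Let $f$ and $g$ be two independent random parabolic elements of $\mathcal{F}$ and let $\Gamma=\langle f,g\rangle\subset\mathcal{F}$ be the group they generate. Then $$\Pr\{\Gamma \text{ is discrete}\}=0.314833\ldots$$ (that is, the probability is a number whose decimal expansion begins $0.314833$).
   Context: $\mathcal{F}\subset PSL(2,\mathbb{C})$ is the group of all matrices $\pm\begin{pmatrix} a & c\\ \bar c & \bar a\end{pmatrix}$ with $|a|^2-|c|^2=1$, acting on the unit disk by $z\mapsto \frac{az+c}{\bar c z+\bar a}$. It is isomorphic to $PSL(2,\mathbb{R})$, and its discrete subgroups are Fuchsian groups. The parabolic elements of $\mathcal{F}$ have the form $$\pm\begin{pmatrix} 1+ix & x e^{i\theta}\\ x e^{-i\theta} & 1-ix\end{pmatrix},\qquad x\in\mathbb{R}\setminus\{0\},\ \theta\in[0,2\pi].$$ A random parabolic element of $\mathcal{F}$ is such a matrix with $\theta$ uniformly distributed in $[0,2\pi]$ and $x=\cot(\eta)$ with $\eta$ uniformly distributed in $[0,\pi]$, where $\theta$ and $\eta$ are independent. *)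

theory Defs
  imports "HOL-Probability.Probability" "HOL-Algebra.Generated_Groups"
begin

definition mat2 :: "complex \<Rightarrow> complex \<Rightarrow> complex \<Rightarrow> complex \<Rightarrow> complex ^ 2 ^ 2" where
  "mat2 a b c d = vector [vector [a, b], vector [c, d]]"

definition SL2C :: "(complex ^ 2 ^ 2) monoid" where
  "SL2C = \<lparr>carrier = {A. det A = 1}, mult = (**), one = mat 1\<rparr>"

definition PSL2C :: "(complex ^ 2 ^ 2) set monoid" where
  "PSL2C = SL2C Mod {mat 1, - mat 1}"

definition pm_class :: "complex ^ 2 ^ 2 \<Rightarrow> (complex ^ 2 ^ 2) set" where
  "pm_class A = {mat 1, - mat 1} #>\<^bsub>SL2C\<^esub> A"

text \<open>The quotient topology: the points of \<^term>\<open>PSL2C\<close> are the cosets themselves,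
  so the preimage of a set \<open>U\<close> of points under \<^term>\<open>pm_class\<close> is \<open>\<Union>U\<close>
  (cf. \<open>quotient_map_pm_class\<close> below).\<close>

definition PSL2C_topology :: "(complex ^ 2 ^ 2) set topology" where
  "PSL2C_topology = topology (\<lambda>U. U \<subseteq> carrier PSL2C \<and>
     openin (top_of_set (carrier SL2C)) (\<Union>U))"

definition PSL2C_borel :: "(complex ^ 2 ^ 2) set measure" where
  "PSL2C_borel = sigma (carrier PSL2C) {U. openin PSL2C_topology U}"

definition disc_group :: "(complex ^ 2 ^ 2) set monoid" where
  "disc_group = PSL2C\<lparr>carrier :=
     {pm_class (mat2 a c (cnj c) (cnj a)) | a c. (cmod a)\<^sup>2 - (cmod c)\<^sup>2 = 1}\<rparr>"

definition discrete_in_PSL2C :: "(complex ^ 2 ^ 2) set set \<Rightarrow> bool" where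
  "discrete_in_PSL2C \<Gamma> \<longleftrightarrow> subtopology PSL2C_topology \<Gamma> = discrete_topology \<Gamma>"

text \<open>Parabolic for \<open>x \<noteq> 0\<close>, the identity for \<open>x = 0\<close>.\<close>

definition parabolic_elt :: "real \<Rightarrow> real \<Rightarrow> (complex ^ 2 ^ 2) set" where
  "parabolic_elt x \<theta> = pm_class
     (mat2 (1 + \<i> * of_real x) (of_real x * cis \<theta>)
           (of_real x * cis (- \<theta>)) (1 - \<i> * of_real x))"

definition uniform_rv :: "'w measure \<Rightarrow> ('w \<Rightarrow> real) \<Rightarrow> real \<Rightarrow> real \<Rightarrow> bool" where
  "uniform_rv M X a b \<longleftrightarrow>
     distributed M lborel X (\<lambda>x. indicator {a..b} x / measure lborel {a..b})"

text \<open>The value of \<^term>\<open>cot\<close> at multiples of \<^term>\<open>pi\<close> is \<open>0\<close> here; this only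
  concerns an event of probability zero, as does \<open>cot (\<eta> \<omega>) = 0\<close>.\<close>

definition random_parabolic :: "'w measure \<Rightarrow> ('w \<Rightarrow> (complex ^ 2 ^ 2) set) \<Rightarrow> bool" where
  "random_parabolic M f \<longleftrightarrow>
     (\<exists>\<theta> \<eta>. uniform_rv M \<theta> 0 (2 * pi) \<and> uniform_rv M \<eta> 0 pi \<and>
        prob_space.indep_var M borel \<theta> borel \<eta> \<and>
        (\<forall>\<omega>\<in>space M. f \<omega> = parabolic_elt (cot (\<eta> \<omega>)) (\<theta> \<omega>)))"

lemma group_SL2C: "group SL2C"
proof (rule groupI)
  fix A assume A: "A \<in> carrier SL2C"
  then have "invertible A" by (simp add: SL2C_def invertible_det_nz)
  then obtain B where B: "A ** B = mat 1" "B ** A = mat 1" unfolding invertible_def by blast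
  then have "det B = 1" using A by (metis (mono_tags, lifting) SL2C_def det_I det_mul mem_Collect_eq
        mult_1_left partial_object.select_convs(1))
  then show "\<exists>y\<in>carrier SL2C. y \<otimes>\<^bsub>SL2C\<^esub> A = \<one>\<^bsub>SL2C\<^esub>" using B by (auto simp: SL2C_def)
qed (auto simp: SL2C_def det_mul matrix_mul_assoc)

lemma uminus_matrix_mul: "(- A) ** B = - (A ** B)" "A ** (- B) = - (A ** B)"
  for A B :: "complex ^ 2 ^ 2"
  by (simp_all add: matrix_matrix_mult_def vec_eq_iff sum_negf)

lemma det_uminus2: "det (- A) = det A" for A :: "complex ^ 2 ^ 2"
  by (simp add: det_2)

lemma pm_class_eq: "pm_class A = {A, - A}"
  by (auto simp: pm_class_def r_coset_def SL2C_def uminus_matrix_mul)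

lemma normal_pm: "{mat 1, - mat 1} \<lhd> SL2C"
proof -
  interpret group SL2C by (rule group_SL2C)
  have "subgroup {mat 1, - mat 1} SL2C"
  proof (rule subgroupI)
    fix a assume a: "a \<in> {mat 1, - mat 1 :: complex ^ 2 ^ 2}"
    then have "inv\<^bsub>SL2C\<^esub> a = a"
      by (intro inv_equality) (auto simp: SL2C_def uminus_matrix_mul det_uminus2)
    with a show "inv\<^bsub>SL2C\<^esub> a \<in> {mat 1, - mat 1}" by simp
  qed (auto simp: SL2C_def uminus_matrix_mul det_uminus2)
  then show ?thesis
    by (intro normalI) (auto simp: r_coset_def l_coset_def SL2C_def uminus_matrix_mul)
qed

lemma group_PSL2C: "group PSL2C"
  unfolding PSL2C_def by (rule normal.factorgroup_is_group[OF normal_pm])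

lemma carrier_PSL2C: "carrier PSL2C = pm_class ` carrier SL2C"
  by (auto simp: PSL2C_def carrier_FactGroup pm_class_def)

lemma Union_preimage_pm_class:
  assumes "U \<subseteq> carrier PSL2C"
  shows "\<Union>U = {A \<in> carrier SL2C. pm_class A \<in> U}"
proof -
  have *: "pm_class (- A) = pm_class A" for A by (auto simp: pm_class_eq)
  have **: "- A \<in> carrier SL2C" if "A \<in> carrier SL2C" for A
    using that by (simp add: SL2C_def det_uminus2)
  have ***: "A \<in> carrier SL2C \<and> pm_class A = X"
    if X: "X \<in> carrier PSL2C" and A: "A \<in> X" for A X
  proof -
    obtain B where B: "B \<in> carrier SL2C" "X = pm_class B"
      using X unfolding carrier_PSL2C by blast
    then have "A = B \<or> A = - B" using A by (simp add: pm_class_eq)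
    then show ?thesis using B * ** by blast
  qed
  have "A \<in> pm_class A" for A by (simp add: pm_class_eq)
  then show ?thesis using *** assms by blast
qed

lemma openin_PSL2C_topology:
  "openin PSL2C_topology U \<longleftrightarrow>
     U \<subseteq> carrier PSL2C \<and> openin (top_of_set (carrier SL2C)) (\<Union>U)"
proof -
  have "istopology (\<lambda>U. U \<subseteq> carrier PSL2C \<and> openin (top_of_set (carrier SL2C)) (\<Union>U))"
    unfolding istopology_def
  proof (intro conjI allI impI)
    fix S T
    assume S: "S \<subseteq> carrier PSL2C \<and> openin (top_of_set (carrier SL2C)) (\<Union>S)"
      and T: "T \<subseteq> carrier PSL2C \<and> openin (top_of_set (carrier SL2C)) (\<Union>T)"
    have "\<Union>(S \<inter> T) = \<Union>S \<inter> \<Union>T"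
    proof -
      have "S \<inter> T \<subseteq> carrier PSL2C" using S by blast
      then show ?thesis
        using S T by (auto simp: Union_preimage_pm_class)
    qed
    then show "openin (top_of_set (carrier SL2C)) (\<Union>(S \<inter> T))"
      using S T by (metis openin_Int)
    show "S \<inter> T \<subseteq> carrier PSL2C" using S by blast
  next
    fix K
    assume K: "\<forall>S\<in>K. S \<subseteq> carrier PSL2C \<and> openin (top_of_set (carrier SL2C)) (\<Union>S)"
    have "openin (top_of_set (carrier SL2C)) (\<Union>(Union ` K))"
      using K by (intro openin_Union) auto
    moreover have "\<Union>(\<Union>K) = \<Union>(Union ` K)" by blast
    ultimately show "openin (top_of_set (carrier SL2C)) (\<Union>(\<Union>K))" by (simp only:)
    show "\<Union>K \<subseteq> carrier PSL2C" using K by blast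
  qed
  then show ?thesis by (simp add: PSL2C_topology_def topology_inverse')
qed

lemma topspace_PSL2C_topology: "topspace PSL2C_topology = carrier PSL2C"
proof -
  have "\<Union>(carrier PSL2C) = carrier SL2C"
    unfolding Union_preimage_pm_class[OF subset_refl] by (auto simp: carrier_PSL2C)
  then have "openin PSL2C_topology (carrier PSL2C)"
    by (simp add: openin_PSL2C_topology)
  then have "carrier PSL2C \<subseteq> topspace PSL2C_topology" by (rule openin_subset)
  moreover have "topspace PSL2C_topology \<subseteq> carrier PSL2C"
    using openin_topspace[of PSL2C_topology] by (simp only: openin_PSL2C_topology)
  ultimately show ?thesis by (rule subset_antisym[rotated])
qed

lemma quotient_map_pm_class:
  "quotient_map (top_of_set (carrier SL2C)) PSL2C_topology pm_class"
  unfolding quotient_map_def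
proof (intro conjI allI impI)
  show "pm_class ` topspace (top_of_set (carrier SL2C)) = topspace PSL2C_topology"
    by (simp add: topspace_PSL2C_topology carrier_PSL2C)
next
  fix U assume "U \<subseteq> topspace PSL2C_topology"
  then have U: "U \<subseteq> carrier PSL2C" by (simp add: topspace_PSL2C_topology)
  show "openin (top_of_set (carrier SL2C))
      {x \<in> topspace (top_of_set (carrier SL2C)). pm_class x \<in> U} \<longleftrightarrow> openin PSL2C_topology U"
    unfolding openin_PSL2C_topology using U by (simp add: Union_preimage_pm_class[OF U])
qed

lemma det_mat2: "det (mat2 a b c d) = a * d - b * c"
  for a b c d :: complex
  by (simp add: mat2_def det_2)

lemma cmod_sq_diff:
  "(cmod a)\<^sup>2 - (cmod c)\<^sup>2 = 1 \<longleftrightarrow> a * cnj a - c * cnj c = 1"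
  by (simp add: complex_mult_cnj cmod_power2 complex_eq_iff)

lemma disc_group_subset: "carrier disc_group \<subseteq> carrier PSL2C"
  by (auto simp: disc_group_def carrier_PSL2C SL2C_def det_mat2 cmod_sq_diff)

lemma subgroup_disc_group: "subgroup (carrier disc_group) PSL2C"
proof -
  interpret S: group SL2C by (rule group_SL2C)
  interpret P: group PSL2C by (rule group_PSL2C)
  interpret N: normal "{mat 1, - mat 1}" SL2C by (rule normal_pm)
  have mult: "pm_class A \<otimes>\<^bsub>PSL2C\<^esub> pm_class B = pm_class (A ** B)"
    if "A \<in> carrier SL2C" "B \<in> carrier SL2C" for A B
    using N.rcos_sum[OF that] by (simp add: PSL2C_def pm_class_def SL2C_def)
  have one: "\<one>\<^bsub>PSL2C\<^esub> = pm_class (mat 1)"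
    by (auto simp: PSL2C_def pm_class_eq)
  have SL: "mat2 a c (cnj c) (cnj a) \<in> carrier SL2C" if "a * cnj a - c * cnj c = 1" for a c
    using that by (simp add: SL2C_def det_mat2)
  have mm: "mat2 a c (cnj c) (cnj a) ** mat2 b d (cnj d) (cnj b) =
      mat2 (a * b + c * cnj d) (a * d + c * cnj b)
        (cnj (a * d + c * cnj b)) (cnj (a * b + c * cnj d))" for a b c d
    by (simp add: mat2_def matrix_matrix_mult_def vec_eq_iff forall_2 sum_2 algebra_simps)
  have m1: "mat 1 = mat2 1 0 (cnj 0) (cnj 1)"
    by (simp add: mat2_def mat_def vec_eq_iff forall_2)
  have F: "carrier disc_group =
      {pm_class (mat2 a c (cnj c) (cnj a)) | a c. a * cnj a - c * cnj c = 1}"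
    by (simp add: disc_group_def cmod_sq_diff)
  show ?thesis
  proof (rule P.subgroupI)
    show "carrier disc_group \<subseteq> carrier PSL2C" by (rule disc_group_subset)
    have "pm_class (mat2 1 0 (cnj 0) (cnj 1)) \<in> carrier disc_group"
      unfolding F by fastforce
    then show "carrier disc_group \<noteq> {}" by blast
  next
    fix X assume "X \<in> carrier disc_group"
    then obtain a c where X: "X = pm_class (mat2 a c (cnj c) (cnj a))"
      and ac: "a * cnj a - c * cnj c = 1" unfolding F by blast
    let ?Y = "mat2 (cnj a) (- c) (cnj (- c)) (cnj (cnj a))"
    have Y: "cnj a * cnj (cnj a) - (- c) * cnj (- c) = 1"
      using ac by (simp add: mult.commute)
    have "pm_class ?Y \<otimes>\<^bsub>PSL2C\<^esub> X = \<one>\<^bsub>PSL2C\<^esub>"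
      unfolding X one m1 mult[OF SL[OF Y] SL[OF ac]] mm
      using ac by (simp add: algebra_simps)
    moreover have YF: "pm_class ?Y \<in> carrier disc_group" unfolding F using Y by blast
    ultimately have "inv\<^bsub>PSL2C\<^esub> X = pm_class ?Y"
      using P.inv_equality disc_group_subset \<open>X \<in> carrier disc_group\<close> by blast
    then show "inv\<^bsub>PSL2C\<^esub> X \<in> carrier disc_group" using YF by simp
  next
    fix X Y assume "X \<in> carrier disc_group" "Y \<in> carrier disc_group"
    then obtain a b c d where X: "X = pm_class (mat2 a c (cnj c) (cnj a))"
      and ac: "a * cnj a - c * cnj c = 1"
      and Y: "Y = pm_class (mat2 b d (cnj d) (cnj b))"
      and bd: "b * cnj b - d * cnj d = 1" unfolding F by blast
    have "(a * b + c * cnj d) * cnj (a * b + c * cnj d)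
        - (a * d + c * cnj b) * cnj (a * d + c * cnj b)
        = (a * cnj a - c * cnj c) * (b * cnj b - d * cnj d)"
      by (simp add: algebra_simps)
    also have "\<dots> = 1" by (simp only: ac bd mult_1_left)
    finally show "X \<otimes>\<^bsub>PSL2C\<^esub> Y \<in> carrier disc_group"
      unfolding X Y mult[OF SL[OF ac] SL[OF bd]] mm F by blast
  qed
qed

lemma group_disc_group: "group disc_group"
proof -
  have "disc_group = PSL2C\<lparr>carrier := carrier disc_group\<rparr>" by (simp add: disc_group_def)
  then show ?thesis
    using subgroup.subgroup_is_group[OF subgroup_disc_group group_PSL2C] by simp
qed

lemma parabolic_elt_in_disc_group: "parabolic_elt x \<theta> \<in> carrier disc_group"
proof -
  have "mat2 (1 + \<i> * of_real x) (of_real x * cis \<theta>) (of_real x * cis (- \<theta>)) (1 - \<i> * of_real x)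
    = mat2 (1 + \<i> * of_real x) (of_real x * cis \<theta>)
        (cnj (of_real x * cis \<theta>)) (cnj (1 + \<i> * of_real x))"
    by (simp add: cis_cnj)
  moreover have "(cmod (1 + \<i> * of_real x))\<^sup>2 - (cmod (of_real x * cis \<theta>))\<^sup>2 = 1"
    by (simp add: cmod_power2 norm_mult power_mult_distrib)
  ultimately show ?thesis
    unfolding parabolic_elt_def disc_group_def by force
qed

end

theory Submission
  imports Defs "HOL-Real_Asymp.Real_Asymp" "HOL-Analysis.Kronecker_Approximation_Theorem"
begin

text \<open>
  Write \<open>f\<close>, \<open>g\<close> as the parabolic elements with parameters \<open>(x, \<theta>)\<close>, \<open>(y, \<phi>)\<close> and put
  \<open>\<kappa> = \<bar>x * y\<bar> * (1 - cos (\<theta> - \<phi>))\<close>, so that \<open>tr (f g)\<close> or \<open>tr (f g\<^sup>-\<^sup>1)\<close> equals \<open>2 - 2 * \<kappa>\<close>. If \<open>\<kappa> \<ge> 2\<close>,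
  a ping-pong argument shows that the group is discrete. If \<open>0 < \<kappa> < 2\<close>, the product is elliptic,
  and unless \<open>\<kappa>\<close> lies in a countable set its rotation angle is an irrational multiple of \<open>\<pi>\<close>, so
  its powers accumulate at the identity. Hence the probability is that of \<open>\<kappa> \<ge> 2\<close>, and integrating
  successively over the angles gives
  \<open>(8 / \<pi>\<^sup>2) * \<integral>\<^sub>0\<^sup>\<pi>\<^sup>/\<^sup>4 arcsin (tan x) dx = (2 * arsinh 1 / \<pi>)\<^sup>2 = 0.3148330442...\<close>.
  Discreteness is expressed through the countably many words in \<open>f\<close> and \<open>g\<close>, which also makes the
  event measurable.
\<close>

section \<open>Numerical bounds\<close>

text \<open>The random variables are cosets, and independence is given for the cosets
  \<open>f\<close> and \<open>g\<close>, not for their four parameters. These are not functions of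
  the cosets: \<theta> is lost when x = 0, and 0 and 2 \<pi> give the same element. So \<kappa> is
  recomputed from sign-invariant, continuous coordinates of a coset (\<open>coord\<close>), and
  independence is passed on through them. The threshold 2 comes from ping-pong: with d = sqrt (2 *
  (1 - cos (\<theta> - \<phi>))) the two generators expand by |x| d and |y| d, and the product |x y|
  d^2 = 2 \<kappa> of these factors has to reach 2 * 2. Below the threshold, groups with a rational
  rotation angle can be discrete or not; they occur for countably many \<kappa> only, a null event,
  so they are never classified. The integrand arcsin (tan x) arises because averaging over the angle
  gives arcsin (k / (1 + sqrt (1 + k^2))), whose argument for k = |cot \<eta>| is the tangent of a
  half angle.\<close>

text \<open>\<open>8119 / 3363\<close> and \<open>3363 / 1393\<close> are continued fraction convergents of \<open>1 + sqrt 2\<close>.\<close>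

lemma sqrt2_bounds: "4756 / 3363 < sqrt (2::real)" "sqrt (2::real) < 1970 / 1393"
proof -
  show "4756 / 3363 < sqrt (2::real)" by (rule real_less_rsqrt) (simp add: power2_eq_square)
  show "sqrt (2::real) < 1970 / 1393" by (rule real_less_lsqrt) (simp_all add: power2_eq_square)
qed

text \<open>The series is ln a = 2 * (sum of y^(2k+1) / (2k+1)) with y = (a - 1) / (a + 1). Each odd
  power is bounded by a short decimal obtained from the previous one and rounded down, which keeps
  the arithmetic small.\<close>

lemma ln_8119_3363_ge: "0.88137353 \<le> ln (8119 / 3363 :: real)"
proof -
  define y :: real where "y = 2378 / 5741"
  define p where "p k = y ^ (2 * k + 1)" for k
  have "(\<Sum>k<9. 2 * p k / real (2 * k + 1)) \<le> ln (8119 / 3363)"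
    using ln_approx_bounds[of "8119 / 3363" 9] by (simp add: p_def y_def)
  moreover have step: "d \<le> p m" if "c \<le> p k" "m = Suc k" "0 \<le> c" "d \<le> c * 0.17157286636" for c d k m
  proof -
    have "0.17157286636 \<le> y * y" by (simp add: y_def)
    then have "c * 0.17157286636 \<le> p k * (y * y)" using that by (intro mult_mono) auto
    then show ?thesis using that by (simp add: p_def mult_ac)
  qed
  moreover have p0: "0.41421355164 \<le> p 0" by (simp add: p_def y_def)
  moreover have p1: "0.07106780634 \<le> p 1" by (rule step[OF p0]) simp_all
  moreover have p2: "0.01219330723 \<le> p 2" by (rule step[OF p1]) simp_all
  moreover have p3: "0.00209204067 \<le> p 3" by (rule step[OF p2]) simp_all
  moreover have p4: "0.00035893741 \<le> p 4" by (rule step[OF p3]) simp_all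
  moreover have p5: "0.00006158392 \<le> p 5" by (rule step[OF p4]) simp_all
  moreover have p6: "0.00001056612 \<le> p 6" by (rule step[OF p5]) simp_all
  moreover have p7: "0.00000181285 \<le> p 7" by (rule step[OF p6]) simp_all
  moreover have p8: "0.00000031103 \<le> p 8" by (rule step[OF p7]) simp_all
  ultimately show ?thesis by (simp add: lessThan_nat_numeral)
qed

text \<open>The same series with all roundings upwards; \<open>2 * r\<close> bounds the tail after
  seven terms by a geometric series, with 15 = 2 * 7 + 1 the first omitted denominator.\<close>

lemma ln_3363_1393_le: "ln (3363 / 1393 :: real) \<le> 0.881374"
proof -
  define y :: real where "y = 985 / 2378"
  define p where "p k = y ^ (2 * k + 1)" for k
  define r where "r = p 7 / (1 - y\<^sup>2) / 15"
  have "ln (3363 / 1393) \<le> (\<Sum>k<7. 2 * p k / real (2 * k + 1)) + 2 * r"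
    using ln_approx_bounds[of "3363 / 1393" 7] by (simp add: p_def y_def r_def)
  moreover have step: "p m \<le> d" if "p k \<le> c" "m = Suc k" "c * 0.17157292705 \<le> d" for c d k m
  proof -
    have "y * y \<le> 0.17157292705" "0 \<le> p k" by (simp_all add: y_def p_def)
    then have "p k * (y * y) \<le> c * 0.17157292705" using that by (intro mult_mono) auto
    then show ?thesis using that by (simp add: p_def mult_ac)
  qed
  moreover have p0: "p 0 \<le> 0.41421362490" by (simp add: p_def y_def)
  moreover have p1: "p 1 \<le> 0.07106784405" by (rule step[OF p0]) simp_all
  moreover have p2: "p 2 \<le> 0.01219331803" by (rule step[OF p1]) simp_all
  moreover have p3: "p 3 \<le> 0.00209204327" by (rule step[OF p2]) simp_all
  moreover have p4: "p 4 \<le> 0.00035893799" by (rule step[OF p3]) simp_all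
  moreover have p5: "p 5 \<le> 0.00006158405" by (rule step[OF p4]) simp_all
  moreover have p6: "p 6 \<le> 0.00001056616" by (rule step[OF p5]) simp_all
  moreover have p7: "p 7 \<le> 0.00000181287" by (rule step[OF p6]) simp_all
  moreover have "r \<le> p 7 / 0.8 / 15" unfolding r_def
    by (intro divide_right_mono divide_left_mono) (simp_all add: y_def p_def power2_eq_square)
  ultimately show ?thesis by (simp add: lessThan_nat_numeral)
qed

lemma arsinh_1_bounds: "arsinh 1 \<in> {0.88137353 .. (0.881374::real)}"
proof -
  have "ln (8119 / 3363) \<le> ln (1 + sqrt (2::real))" using sqrt2_bounds(1) by simp
  moreover have "ln (1 + sqrt 2) \<le> ln (3363 / 1393 :: real)"
    using sqrt2_bounds by (subst ln_le_cancel_iff) (auto simp: add_pos_pos)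
  ultimately show ?thesis using ln_8119_3363_ge ln_3363_1393_le by (simp add: arsinh_real_def)
qed

text \<open>The value exceeds the lower end by only about 4.4e-8, which forces a lower bound for
  \<open>arsinh 1\<close> accurate to about 6e-8. The upper end leaves far more room, so a cruder
  bound suffices there.\<close>

lemma arsinh_1_over_pi_bounds: "4 * (arsinh 1)\<^sup>2 / pi\<^sup>2 \<in> {0.314833 ..< (0.314834::real)}"
proof -
  have L: "0.88137353 \<le> arsinh (1::real)" "arsinh (1::real) \<le> 0.881374"
    using arsinh_1_bounds by simp_all
  have "0.314833 * pi\<^sup>2 \<le> 0.314833 * 3.1415926535899\<^sup>2"
    using pi_approx by (intro mult_left_mono power_mono) auto
  also have "\<dots> \<le> 4 * (0.88137353::real)\<^sup>2" by (simp add: power2_eq_square)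
  also have "\<dots> \<le> 4 * (arsinh 1)\<^sup>2" using L by (intro mult_left_mono power_mono) auto
  finally have 1: "0.314833 * pi\<^sup>2 \<le> 4 * (arsinh 1)\<^sup>2" .
  have "4 * (arsinh 1)\<^sup>2 \<le> 4 * (0.881374::real)\<^sup>2"
    using L by (intro mult_left_mono power_mono) auto
  also have "\<dots> < 0.314834 * 3.141592653588\<^sup>2" by (simp add: power2_eq_square)
  also have "\<dots> \<le> 0.314834 * pi\<^sup>2"
    using pi_approx by (intro mult_left_mono power_mono) auto
  finally have 2: "4 * (arsinh 1)\<^sup>2 < 0.314834 * pi\<^sup>2" .
  have "pi\<^sup>2 > 0" by simp
  then show ?thesis using 1 2 by (simp add: pos_le_divide_eq pos_divide_less_eq)
qed

section \<open>Integrals\<close>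

text \<open>This is the k-derivative needed in \<open>integral_arctan_sin_sq\<close>. The
  substitution t = cot a turns it into the integral of 1 / ((1 + t^2)^2 + k^2) over the positive
  half-line.\<close>

lemma integral_sin_sq_over:
  fixes k :: real
  assumes k: "k > 0"
  defines "c \<equiv> sqrt (1 + k\<^sup>2)"
  shows "integral {0..pi/2} (\<lambda>a. (sin a)\<^sup>2 / (1 + k\<^sup>2 * (sin a) ^ 4))
           = pi / (2 * c * sqrt (2 * (1 + c)))"
proof -
  have c1: "c > 1" using k by (simp add: c_def)
  have c2: "c\<^sup>2 = 1 + k\<^sup>2" by (simp add: c_def)
  define p where "p = sqrt (2 * (c - 1))"
  define r where "r = sqrt (2 * (1 + c))"
  have p: "p > 0" "p\<^sup>2 = 2 * (c - 1)" and r: "r > 0" "r\<^sup>2 = 2 * (1 + c)"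
    using c1 by (simp_all add: p_def r_def)
  \<comment> \<open>With u = t - c/t and v = t + c/t, the quantity ((1 + t^2)^2 + k^2) / t^2 equals
    both u^2 + r^2 and v^2 - p^2, while u' - v' = 2 c / t^2. So the integrand splits into an arctan
    part in u and a logarithmic part in v.\<close>
  define G where "G t = (arctan ((t - c / t) / r) / r - ln ((t + c / t - p) / (t + c / t + p)) / (2 * p)) / (2 * c)"
    for t :: real
  \<comment> \<open>In the notation above, v^2 = u^2 + 4 c and 4 c > 2 (c - 1) = p^2; this keeps the
    argument of the logarithm positive.\<close>
  have pos: "t + c / t - p > 0" if "t > 0" for t
  proof -
    have "(t + c / t)\<^sup>2 = (t - c / t)\<^sup>2 + 4 * c"
      using that by (simp add: power2_diff power2_sum)
    then have "p\<^sup>2 < (t + c / t)\<^sup>2"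
      unfolding p(2) using c1 by (simp add: add_nonneg_pos add_strict_increasing2)
    then have "p < t + c / t"
      using that c1 by (intro power2_less_imp_less[of p "t + c / t"]) auto
    then show ?thesis by simp
  qed
  have dG: "(G has_real_derivative 1 / ((1 + t\<^sup>2)\<^sup>2 + k\<^sup>2)) (at t)" if t: "t > 0" for t
  proof -
    define u where "u s = s - c / s" for s :: real
    define v where "v s = s + c / s" for s :: real
    have G_uv: "G = (\<lambda>s. (arctan (u s / r) / r - ln ((v s - p) / (v s + p)) / (2 * p)) / (2 * c))"
      by (simp add: G_def u_def v_def fun_eq_iff)
    have du: "(u has_real_derivative 1 + c / t\<^sup>2) (at t)"
      unfolding u_def[abs_def] using t by (auto intro!: derivative_eq_intros simp: power2_eq_square)
    have dv: "(v has_real_derivative 1 - c / t\<^sup>2) (at t)"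
      unfolding v_def[abs_def] using t by (auto intro!: derivative_eq_intros simp: power2_eq_square)
    have vpos: "v t - p > 0" "v t + p > 0"
      using pos[OF t] p t c1 by (simp_all add: v_def add_pos_pos)
    define D where "D = ((1 + t\<^sup>2)\<^sup>2 + k\<^sup>2) / t\<^sup>2"
    have k2: "k\<^sup>2 = c\<^sup>2 - 1" using c2 by simp
    have Dpos: "(1 + t\<^sup>2)\<^sup>2 + k\<^sup>2 > 0" using k by (simp add: add_nonneg_pos)
    have D0: "D = t\<^sup>2 + 2 + c\<^sup>2 / t\<^sup>2"
    proof -
      have "(1 + t\<^sup>2)\<^sup>2 + (c\<^sup>2 - 1) = (t\<^sup>2 + 2 + c\<^sup>2 / t\<^sup>2) * t\<^sup>2"
        using t by (simp add: algebra_simps power2_sum power2_eq_square)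
      then show ?thesis using t by (simp add: D_def k2)
    qed
    have u2: "(u t)\<^sup>2 = t\<^sup>2 - 2 * c + c\<^sup>2 / t\<^sup>2" and v2: "(v t)\<^sup>2 = t\<^sup>2 + 2 * c + c\<^sup>2 / t\<^sup>2"
      using t unfolding u_def v_def by (simp_all add: power2_diff power2_sum power_divide)
    have D: "r\<^sup>2 + (u t)\<^sup>2 = D" "(v t)\<^sup>2 - p\<^sup>2 = D"
      unfolding r p u2 v2 D0 by simp_all
    have 1: "((\<lambda>s. arctan (u s / r) / r) has_real_derivative (1 + c / t\<^sup>2) / D) (at t)"
    proof -
      have "((\<lambda>s. arctan (u s / r) / r) has_real_derivative
              inverse (1 + (u t / r)\<^sup>2) * ((1 + c / t\<^sup>2) / r) / r) (at t)"
        by (intro DERIV_cdivide DERIV_chain2[OF DERIV_arctan] du)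
      moreover have "1 + (u t / r)\<^sup>2 = D / r\<^sup>2"
        using r(1) by (simp add: D(1)[symmetric] power_divide add_divide_distrib)
      ultimately show ?thesis using r(1) by (simp add: power2_eq_square)
    qed
    have 2: "((\<lambda>s. ln ((v s - p) / (v s + p)) / (2 * p)) has_real_derivative (1 - c / t\<^sup>2) / D) (at t)"
    proof -
      define e where "e = 1 - c / t\<^sup>2"
      have dv': "((\<lambda>s. v s - p) has_real_derivative e) (at t)" "((\<lambda>s. v s + p) has_real_derivative e) (at t)"
        using DERIV_diff[OF dv DERIV_const] DERIV_add[OF dv DERIV_const] by (simp_all add: e_def)
      have "((\<lambda>s. ln ((v s - p) / (v s + p)) / (2 * p)) has_real_derivative
              1 / ((v t - p) / (v t + p)) *
              ((e * (v t + p) - (v t - p) * e) / ((v t + p) * (v t + p))) / (2 * p)) (at t)"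
        using vpos by (intro DERIV_cdivide DERIV_chain2[OF DERIV_ln_divide] DERIV_divide dv') auto
      moreover have "e * (v t + p) - (v t - p) * e = 2 * p * e" by (simp add: algebra_simps)
      moreover have "D = (v t - p) * (v t + p)"
        unfolding D(2)[symmetric] by (simp add: power2_eq_square algebra_simps)
      moreover have "1 / (x / y) * (2 * p * e / (y * y)) / (2 * p) = e / (x * y)"
        if "x > 0" "y > 0" for x y :: real
        using that p(1) by simp
      ultimately show ?thesis using vpos by (simp only: e_def)
    qed
    have "(G has_real_derivative ((1 + c / t\<^sup>2) / D - (1 - c / t\<^sup>2) / D) / (2 * c)) (at t)"
      unfolding G_uv by (intro DERIV_cdivide DERIV_diff 1 2)
    moreover have "((1 + c / t\<^sup>2) / D - (1 - c / t\<^sup>2) / D) = 2 * c / t\<^sup>2 / D"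
      by (simp add: diff_divide_distrib[symmetric])
    moreover have "2 * c / t\<^sup>2 / D / (2 * c) = 1 / ((1 + t\<^sup>2)\<^sup>2 + k\<^sup>2)"
      using t c1 Dpos by (simp add: D_def)
    ultimately show ?thesis by simp
  qed
  define f where "f a = (sin a)\<^sup>2 / (1 + k\<^sup>2 * (sin a) ^ 4)" for a :: real
  have nz: "1 + k\<^sup>2 * (sin a) ^ 4 > 0" for a :: real
    by (simp add: add_pos_nonneg)
  have contf: "continuous_on A f" for A
    unfolding f_def using nz by (intro continuous_intros) (auto simp: less_imp_neq[symmetric])
  have dF: "((\<lambda>a. - G (cot a)) has_real_derivative f a) (at a)"
    if a: "0 < a" "a < pi / 2" for a
  proof -
    have s: "sin a > 0" "cos a > 0" using a by (auto intro: sin_gt_zero cos_gt_zero)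
    then have cot: "cot a > 0" by (simp add: cot_def)
    have "((\<lambda>a. - G (cot a)) has_real_derivative
       - (1 / ((1 + (cot a)\<^sup>2)\<^sup>2 + k\<^sup>2) * - inverse ((sin a)\<^sup>2))) (at a)"
      using s by (intro DERIV_minus DERIV_chain2[where f = G and g = cot] dG cot DERIV_cot) auto
    moreover have "1 + (cot a)\<^sup>2 = 1 / (sin a)\<^sup>2"
      using s by (simp add: cot_def field_simps)
    moreover have "1 / ((1 / (sin a)\<^sup>2)\<^sup>2 + k\<^sup>2) * inverse ((sin a)\<^sup>2) = f a"
    proof -
      define x where "x = (sin a)\<^sup>2"
      have x: "x > 0" using s by (simp add: x_def)
      have "(1 / x)\<^sup>2 + k\<^sup>2 = (1 + k\<^sup>2 * x\<^sup>2) / x\<^sup>2"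
        using x by (simp add: add_divide_distrib power_divide)
      then have "1 / ((1 / x)\<^sup>2 + k\<^sup>2) * inverse x = (x\<^sup>2 * inverse x) / (1 + k\<^sup>2 * x\<^sup>2)"
        by (simp only:) simp
      also have "x\<^sup>2 * inverse x = x" using x by (simp add: power2_eq_square)
      also have "x\<^sup>2 = sin a ^ 4" by (simp add: x_def flip: power_mult)
      finally show ?thesis by (simp only: f_def x_def)
    qed
    ultimately show ?thesis by (simp only: minus_mult_minus minus_mult_right minus_minus)
  qed
  \<comment> \<open>At both ends of the half-line the quotient inside the logarithm tends to 1, so
    only the jump of the arctan term from - pi/2 to pi/2 contributes.\<close>
  have G_top: "(G \<longlongrightarrow> pi / (4 * c * r)) at_top"
  proof -
    have "filterlim (\<lambda>t. (t - c / t) / r) at_top at_top" using c1 r(1) by real_asymp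
    then have 1: "((\<lambda>t. arctan ((t - c / t) / r)) \<longlongrightarrow> pi / 2) at_top"
      using filterlim_compose tendsto_arctan_at_top by blast
    have "((\<lambda>t. (t + c / t - p) / (t + c / t + p)) \<longlongrightarrow> 1) at_top"
      using c1 by real_asymp
    from tendsto_ln[OF this] have 2: "((\<lambda>t. ln ((t + c / t - p) / (t + c / t + p))) \<longlongrightarrow> 0) at_top"
      by simp
    have "((\<lambda>t. (arctan ((t - c / t) / r) / r
        - ln ((t + c / t - p) / (t + c / t + p)) / (2 * p)) / (2 * c)) \<longlongrightarrow>
        (pi / 2 / r - 0 / (2 * p)) / (2 * c)) at_top"
      using c1 r(1) p(1) by (intro tendsto_intros 1 2) auto
    then show ?thesis by (simp add: G_def[abs_def] mult_ac)
  qed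
  have G_0: "(G \<longlongrightarrow> - pi / (4 * c * r)) (at_right 0)"
  proof -
    have "filterlim (\<lambda>t. (t - c / t) / r) at_bot (at_right 0)" using c1 r(1) by real_asymp
    then have 1: "((\<lambda>t. arctan ((t - c / t) / r)) \<longlongrightarrow> - (pi / 2)) (at_right 0)"
      using filterlim_compose tendsto_arctan_at_bot by blast
    have "((\<lambda>t. (t + c / t - p) / (t + c / t + p)) \<longlongrightarrow> 1) (at_right 0)"
      using c1 by real_asymp
    from tendsto_ln[OF this] have 2: "((\<lambda>t. ln ((t + c / t - p) / (t + c / t + p))) \<longlongrightarrow> 0) (at_right 0)"
      by simp
    have "((\<lambda>t. (arctan ((t - c / t) / r) / r
        - ln ((t + c / t - p) / (t + c / t + p)) / (2 * p)) / (2 * c)) \<longlongrightarrow>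
        (- (pi / 2) / r - 0 / (2 * p)) / (2 * c)) (at_right 0)"
      using c1 r(1) p(1) by (intro tendsto_intros 1 2) auto
    then show ?thesis by (simp add: G_def[abs_def] mult_ac)
  qed
  have cot_top: "filterlim cot at_top (at_right (0::real))"
    unfolding cot_def[abs_def] by real_asymp
  have cot_0: "filterlim cot (at_right 0) (at_left (pi / 2))"
  proof -
    have "(cot \<longlongrightarrow> cot (pi/2)) (at_left (pi / 2))"
      by (intro tendsto_intros) auto
    moreover have "\<forall>\<^sub>F x in at_left (pi/2). cot x \<in> {0<..} \<and> cot x \<noteq> 0"
    proof (rule eventually_mono[OF eventually_at_left_real[of 0 "pi/2"]])
      fix x :: real assume "x \<in> {0<..<pi/2}"
      then have "sin x > 0" "cos x > 0" by (auto intro: sin_gt_zero cos_gt_zero)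
      then show "cot x \<in> {0<..} \<and> cot x \<noteq> 0" by (simp add: cot_def)
    qed simp
    moreover have "cot (pi / 2) = 0" by (simp add: cot_def)
    ultimately show ?thesis by (simp add: filterlim_at)
  qed
  have lims: "((\<lambda>a. - G (cot a)) \<longlongrightarrow> - (pi / (4 * c * r))) (at_right 0)"
    "((\<lambda>a. - G (cot a)) \<longlongrightarrow> - (- pi / (4 * c * r))) (at_left (pi / 2))"
    by (rule tendsto_minus filterlim_compose[OF G_top cot_top] filterlim_compose[OF G_0 cot_0])+
  \<comment> \<open>The endpoints correspond to t = \<infinity> and t = 0, where the antiderivative
    exists only as a one-sided limit; hence the improper form of the fundamental theorem.\<close>
  have "(LBINT x=ereal 0..ereal (pi/2). f x) = - (- pi / (4 * c * r)) - - (pi / (4 * c * r))"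
  proof (rule interval_integral_FTC_nonneg(2))
    show "\<And>x. ereal 0 < ereal x \<Longrightarrow> ereal x < ereal (pi / 2) \<Longrightarrow> isCont f x"
      using contf[of UNIV] by (simp add: continuous_on_eq_continuous_at)
    show "AE x in lborel. ereal 0 < ereal x \<longrightarrow> ereal x < ereal (pi / 2) \<longrightarrow> 0 \<le> f x"
      using nz by (auto simp: f_def less_imp_le)
  qed (use dF lims in \<open>auto simp: ereal_tendsto_simps\<close>)
  also have "(LBINT x=ereal 0..ereal (pi/2). f x) = integral {0..pi/2} f"
    using contf by (intro interval_integral_eq_integral borel_integrable_atLeastAtMost') auto
  finally show ?thesis by (simp add: f_def[abs_def] r_def)
qed

text \<open>Both sides vanish at k = 0 and have the same derivative for k > 0. The right-hand side
  is differentiated for k > 0 only, so its continuity on the closed interval is what connects the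
  two facts.\<close>

lemma integral_arctan_sin_sq:
  fixes k :: real
  assumes "k \<ge> 0"
  shows "integral {0..pi/2} (\<lambda>a. arctan (k * (sin a)\<^sup>2)) = pi / 2 * arcsin (k / (1 + sqrt (1 + k\<^sup>2)))"
proof -
  define F where "F k = integral {0..pi/2} (\<lambda>a. arctan (k * (sin a)\<^sup>2))" for k :: real
  define R where "R k = pi / 2 * arcsin (k / (1 + sqrt (1 + k\<^sup>2)))" for k :: real
  have dF: "(F has_real_derivative integral {0..pi/2} (\<lambda>a. (sin a)\<^sup>2 / (1 + k\<^sup>2 * (sin a) ^ 4))) (at k)" for k
  proof -
    have "((\<lambda>k. integral (cbox 0 (pi/2)) (\<lambda>a. arctan (k * (sin a)\<^sup>2))) has_real_derivative
            integral (cbox 0 (pi/2)) (\<lambda>a. inverse (1 + (k * (sin a)\<^sup>2)\<^sup>2) * (sin a)\<^sup>2)) (at k within UNIV)"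
    proof (rule leibniz_rule_field_derivative)
      show "((\<lambda>k. arctan (k * (sin a)\<^sup>2)) has_real_derivative inverse (1 + (k * (sin a)\<^sup>2)\<^sup>2) * (sin a)\<^sup>2)
              (at k within UNIV)" for k a :: real
        by (rule DERIV_chain2[OF DERIV_arctan]) (auto intro!: derivative_eq_intros)
      show "(\<lambda>a. arctan (k * (sin a)\<^sup>2)) integrable_on cbox 0 (pi/2)" for k :: real
        by (intro integrable_continuous continuous_intros)
      have "1 + (fst x * (sin (snd x))\<^sup>2)\<^sup>2 \<noteq> 0" for x :: "real \<times> real"
        by (smt (verit) zero_le_power2)
      then show "continuous_on (UNIV \<times> cbox 0 (pi/2))
              (\<lambda>(k, a). inverse (1 + (k * (sin a)\<^sup>2)\<^sup>2) * (sin a)\<^sup>2 :: real)"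
        unfolding split_beta by (intro continuous_intros) auto
    qed auto
    moreover have "inverse (1 + (k * (sin a)\<^sup>2)\<^sup>2) * (sin a)\<^sup>2 = (sin a)\<^sup>2 / (1 + k\<^sup>2 * (sin a) ^ 4)" for a
      by (simp add: power_mult_distrib inverse_eq_divide flip: power_mult)
    ultimately show ?thesis by (simp add: F_def[abs_def])
  qed
  have dR: "(R has_real_derivative pi / (2 * sqrt (1 + k\<^sup>2) * sqrt (2 * (1 + sqrt (1 + k\<^sup>2))))) (at k)"
    if k: "k > 0" for k
  proof -
    define c where "c = sqrt (1 + k\<^sup>2)"
    define r where "r = sqrt (2 * (1 + c))"
    have c: "c > 1" "c\<^sup>2 = 1 + k\<^sup>2" using k by (simp_all add: c_def)
    have r: "r > 0" "r\<^sup>2 = 2 * (1 + c)" using c by (simp_all add: r_def)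
    define z where "z = k / (1 + c)"
    have k2: "k\<^sup>2 = (c - 1) * (c + 1)" using c(2) by (simp add: power2_eq_square algebra_simps)
    have "1 - z\<^sup>2 = 1 - (c - 1) / (1 + c)"
    proof -
      have "(1 + c)\<^sup>2 = (c + 1) * (1 + c)" by (simp add: power2_eq_square)
      then show ?thesis using c(1) unfolding z_def power_divide k2 by simp
    qed
    also have "\<dots> = 2 / (1 + c)" using c(1) by (simp add: diff_divide_eq_iff)
    also have "\<dots> = 4 / r\<^sup>2" unfolding r(2) using c(1) by (simp add: frac_eq_eq)
    also have "\<dots> = (2 / r)\<^sup>2" by (simp add: power_divide)
    finally have z2: "1 - z\<^sup>2 = (2 / r)\<^sup>2" .
    have "(2 / r)\<^sup>2 > 0" using r(1) by simp
    then have "z\<^sup>2 < 1" unfolding z2[symmetric] by simp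
    then have "\<bar>z\<bar> < 1" by (simp only: abs_square_less_1)
    then have z1: "-1 < z" "z < 1" by linarith+
    have dc: "((\<lambda>k. 1 + sqrt (1 + k\<^sup>2)) has_real_derivative k / c) (at k)"
    proof -
      have "((\<lambda>k. 1 + k\<^sup>2) has_real_derivative 2 * k) (at k)"
        by (auto intro!: derivative_eq_intros)
      from DERIV_chain2[OF DERIV_real_sqrt this]
      have "((\<lambda>k. sqrt (1 + k\<^sup>2)) has_real_derivative inverse c / 2 * (2 * k)) (at k)"
        by (simp add: c_def add_pos_nonneg)
      from DERIV_add[OF DERIV_const this] show ?thesis by (simp add: inverse_eq_divide)
    qed
    have dz: "((\<lambda>k. k / (1 + sqrt (1 + k\<^sup>2))) has_real_derivative
        (1 * (1 + c) - k * (k / c)) / ((1 + c) * (1 + c))) (at k)"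
    proof -
      have "1 + sqrt (1 + k\<^sup>2) \<noteq> 0" using c(1) unfolding c_def by linarith
      from DERIV_divide[OF DERIV_ident dc this] show ?thesis unfolding c_def .
    qed
    have "1 * (1 + c) - k * (k / c) = (1 + c) - k\<^sup>2 / c" by (simp add: power2_eq_square)
    also have "\<dots> = (1 + c) / c" 
    proof -
      have "k\<^sup>2 = c * c - 1" unfolding k2 by (simp add: algebra_simps)
      then show ?thesis using c(1) by (simp add: add_divide_distrib diff_divide_distrib)
    qed
    finally have "(1 * (1 + c) - k * (k / c)) / ((1 + c) * (1 + c)) = 2 / (c * r\<^sup>2)"
      unfolding r(2) using c(1) by (simp add: frac_eq_eq)
    with dz have dz: "((\<lambda>k. k / (1 + sqrt (1 + k\<^sup>2))) has_real_derivative 2 / (c * r\<^sup>2)) (at k)" by simp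
    have "(R has_real_derivative pi / 2 * (inverse (sqrt (1 - z\<^sup>2)) * (2 / (c * r\<^sup>2)))) (at k)"
      unfolding R_def[abs_def] z_def c_def using z1[unfolded z_def c_def] dz[unfolded c_def]
      by (intro DERIV_cmult DERIV_chain2[where f = arcsin] DERIV_arcsin) auto
    moreover have "inverse (sqrt (1 - z\<^sup>2)) = r / 2" unfolding z2 using r(1) by (simp add: inverse_eq_divide)
    moreover have "pi / 2 * (r / 2 * (2 / (c * r\<^sup>2))) = pi / (2 * c * r)"
      using r(1) by (simp add: power2_eq_square)
    ultimately show ?thesis unfolding c_def[symmetric] r_def[symmetric] by metis
  qed
  show ?thesis
  proof (cases "k = 0")
    case False
    with assms have k: "0 < k" by simp
    have contR: "continuous_on {0..k} R"
    proof -
      have "k / (1 + sqrt (1 + k\<^sup>2)) \<in> {-1..1}" if "k \<ge> 0" for k :: real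
      proof -
        have "k \<le> sqrt (1 + k\<^sup>2)" by (rule real_le_rsqrt) simp
        then have "k / (1 + sqrt (1 + k\<^sup>2)) \<le> 1" "0 \<le> k / (1 + sqrt (1 + k\<^sup>2))"
          using that by (auto simp: divide_le_eq intro: divide_nonneg_pos add_pos_nonneg)
        then show ?thesis by simp
      qed
      moreover have "1 + sqrt (1 + x\<^sup>2) \<noteq> 0" for x :: real
        by (smt (verit) real_sqrt_ge_zero zero_le_power2)
      ultimately show ?thesis unfolding R_def[abs_def]
        by (intro continuous_intros) auto
    qed
    have "(\<lambda>k. F k - R k) k = (\<lambda>k. F k - R k) 0"
    proof (rule DERIV_isconst2[where a = 0 and b = k])
      have "continuous_on {0..k} F"
        using dF by (meson DERIV_isCont continuous_at_imp_continuous_on)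
      then show "continuous_on {0..k} (\<lambda>k. F k - R k)" using contR by (intro continuous_intros)
      show "((\<lambda>k. F k - R k) has_real_derivative 0) (at x)" if "0 < x" "x < k" for x
        using DERIV_diff[OF dF dR[OF that(1)]] integral_sin_sq_over[OF that(1)] by simp
    qed (use k in auto)
    moreover have "F 0 = 0" "R 0 = 0" by (simp_all add: F_def R_def)
    ultimately show ?thesis by (simp add: F_def R_def)
  qed simp
qed

section \<open>The integral of arcsin (tan x)\<close>

lemma artanh_div_sqrt: "artanh (z / sqrt (1 + z\<^sup>2)) = arsinh z" for z :: real
proof -
  have "tanh (arsinh z) = z / sqrt (1 + z\<^sup>2)"
    by (simp add: tanh_def cosh_arsinh_real add.commute)
  then show ?thesis by (metis artanh_tanh_real)
qed

text \<open>With s^2 = 1 + z^2 the denominator is s^2 - (z cos a)^2, so the substitution w = cos a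
  leads to an \<open>artanh\<close>.\<close>

lemma integral_sin_over:
  fixes z :: real
  assumes z: "z > 0"
  shows "integral {0..pi/2} (\<lambda>a. sin a / (1 + (z * sin a)\<^sup>2)) = arsinh z / (z * sqrt (1 + z\<^sup>2))"
proof -
  define s where "s = sqrt (1 + z\<^sup>2)"
  have s: "s > 0" "s\<^sup>2 = 1 + z\<^sup>2" by (simp_all add: s_def add_pos_nonneg)
  define G where "G a = - (artanh (z / s * cos a) / (z * s))" for a
  have "z < s" unfolding s_def by (rule real_less_rsqrt) simp
  then have zs: "0 < z / s" "z / s < 1" using z s by simp_all
  have bnd: "\<bar>z / s * cos a\<bar> < 1" for a
  proof -
    have "\<bar>z / s * cos a\<bar> = z / s * \<bar>cos a\<bar>" using z s(1) by (simp add: abs_mult)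
    also have "\<dots> \<le> z / s * 1" using zs by (intro mult_left_mono) auto
    finally show ?thesis using zs by simp
  qed
  have dG: "(G has_real_derivative sin a / (1 + (z * sin a)\<^sup>2)) (at a)" for a
  proof -
    have "((\<lambda>a. z / s * cos a) has_real_derivative z / s * - sin a) (at a)"
      by (intro DERIV_cmult DERIV_cos)
    from DERIV_chain2[OF artanh_real_has_field_derivative[OF bnd] this]
    have "((\<lambda>a. artanh (z / s * cos a)) has_real_derivative
             1 / (1 - (z / s * cos a)\<^sup>2) * (z / s * - sin a)) (at a)" .
    from DERIV_minus[OF DERIV_cdivide[OF this]]
    have 1: "(G has_real_derivative - (1 / (1 - (z / s * cos a)\<^sup>2) * (z / s * - sin a) / (z * s))) (at a)"
      unfolding G_def[abs_def] .
    have p: "1 + (z * sin a)\<^sup>2 > 0" by (simp add: add_pos_nonneg)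
    have "(z * cos a)\<^sup>2 = z\<^sup>2 - (z * sin a)\<^sup>2" by (simp add: power_mult_distrib cos_squared_eq algebra_simps)
    then have "s\<^sup>2 - (z * cos a)\<^sup>2 = 1 + (z * sin a)\<^sup>2" using s by simp
    then have "1 - (z / s * cos a)\<^sup>2 = (1 + (z * sin a)\<^sup>2) / s\<^sup>2"
      using s(1) by (simp add: power_mult_distrib power_divide divide_simps)
    then have "1 / (1 - (z / s * cos a)\<^sup>2) = s\<^sup>2 / (1 + (z * sin a)\<^sup>2)" by simp
    then have "- (1 / (1 - (z / s * cos a)\<^sup>2) * (z / s * - sin a) / (z * s)) =
        s\<^sup>2 / (1 + (z * sin a)\<^sup>2) * (sin a / s\<^sup>2)"
      using z s(1) by (simp add: power2_eq_square)
    also have "\<dots> = sin a / (1 + (z * sin a)\<^sup>2)" using s(1) by simp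
    finally show ?thesis using 1 by simp
  qed
  have "((\<lambda>a. sin a / (1 + (z * sin a)\<^sup>2)) has_integral G (pi/2) - G 0) {0..pi/2}"
    using dG by (intro fundamental_theorem_of_calculus)
      (auto simp: has_real_derivative_iff_has_vector_derivative[symmetric] intro: DERIV_subset)
  then show ?thesis
    using artanh_div_sqrt[of z] by (simp add: integral_unique G_def s_def)
qed

text \<open>arctan (sin a) is inverse to arcsin (tan x), so partial integration reduces the wanted
  integral to the value at z = 1. The parameter z is there to make this value accessible by
  differentiation.\<close>

definition arctan_sin_integral :: "real \<Rightarrow> real" where
  "arctan_sin_integral z = integral {0..pi/2} (\<lambda>a. arctan (z * sin a))"

lemma arctan_sin_integral_deriv:
  "(arctan_sin_integral has_real_derivative integral {0..pi/2} (\<lambda>a. sin a / (1 + (z * sin a)\<^sup>2))) (at z)"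
proof -
  have "((\<lambda>z. integral (cbox 0 (pi/2)) (\<lambda>a. arctan (z * sin a))) has_real_derivative
          integral (cbox 0 (pi/2)) (\<lambda>a. inverse (1 + (z * sin a)\<^sup>2) * sin a)) (at z within UNIV)"
  proof (rule leibniz_rule_field_derivative)
    show "((\<lambda>z. arctan (z * sin a)) has_real_derivative inverse (1 + (z * sin a)\<^sup>2) * sin a)
            (at z within UNIV)" for z a :: real
      by (rule DERIV_chain2[OF DERIV_arctan]) (auto intro!: derivative_eq_intros)
    show "(\<lambda>a. arctan (z * sin a)) integrable_on cbox 0 (pi/2)" for z :: real
      by (intro integrable_continuous continuous_intros)
    have "1 + (fst x * sin (snd x))\<^sup>2 \<noteq> 0" for x :: "real \<times> real"
      by (smt (verit) zero_le_power2)
    then show "continuous_on (UNIV \<times> cbox 0 (pi/2))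
            (\<lambda>(z, a). inverse (1 + (z * sin a)\<^sup>2) * sin a :: real)"
      unfolding split_beta by (intro continuous_intros) auto
  qed auto
  then show ?thesis
    by (simp add: arctan_sin_integral_def[abs_def] inverse_eq_divide)
qed

text \<open>Dominated convergence: the integrand tends to pi/2 except at a = 0. The limit fixes the
  constant in the reflection formula.\<close>

lemma arctan_sin_integral_at_top: "(\<lambda>n. arctan_sin_integral (real n)) \<longlonglongrightarrow> pi\<^sup>2 / 4"
proof -
  define g where "g a = (if a = 0 then 0 else pi / 2)" for a :: real
  have "(\<lambda>n. integral {0..pi/2} (\<lambda>a. arctan (real n * sin a))) \<longlonglongrightarrow> integral {0..pi/2} g"
  proof (rule dominated_convergence)
    show "(\<lambda>a. arctan (real n * sin a)) integrable_on {0..pi/2}" for n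
      by (intro integrable_continuous_real continuous_intros)
    show "(\<lambda>_. pi / 2) integrable_on {0..pi/2}" by (rule integrable_const_ivl)
    show "norm (arctan (real n * sin a)) \<le> pi / 2" for n a
      using arctan_bounded[of "real n * sin a"] by auto
    show "(\<lambda>n. arctan (real n * sin a)) \<longlonglongrightarrow> g a" if a: "a \<in> {0..pi/2}" for a
    proof (cases "a = 0")
      case False
      then have "sin a > 0" using a by (intro sin_gt_zero) auto
      then have "filterlim (\<lambda>n. real n * sin a) at_top sequentially"
        by (intro filterlim_at_top_mult_tendsto_pos[OF tendsto_const _ filterlim_real_sequentially])
      from filterlim_compose[OF tendsto_arctan_at_top this] show ?thesis using False by (simp add: g_def)
    qed (simp add: g_def)
  qed
  also have "integral {0..pi/2} g = integral {0..pi/2} (\<lambda>_. pi / 2)"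
    by (rule integral_spike[of "{0}"]) (auto simp: g_def)
  also have "\<dots> = pi\<^sup>2 / 4" by (simp add: power2_eq_square)
  finally show ?thesis by (simp add: arctan_sin_integral_def)
qed

text \<open>The inversion \<open>z \<mapsto> 1 / z\<close> exchanges the two halves of the integral
  \<open>\<integral> arsinh z / (z * sqrt (1 + z\<^sup>2)) dz\<close> up to the total derivative of
  \<open>arsinh z * arsinh (1 / z)\<close>, which makes the value at \<open>z = 1\<close> elementary.\<close>

lemma arctan_sin_integral_reflect:
  assumes "z > 0"
  shows "arctan_sin_integral z + arctan_sin_integral (1 / z) + arsinh z * arsinh (1 / z) = pi\<^sup>2 / 4"
proof -
  let ?H = arctan_sin_integral
  define T where "T z = ?H z + ?H (1 / z) + arsinh z * arsinh (1 / z)" for z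
  have dH: "(?H has_real_derivative arsinh z / (z * sqrt (1 + z\<^sup>2))) (at z)" if "z > 0" for z
    using arctan_sin_integral_deriv[of z] unfolding integral_sin_over[OF that] .
  have dT: "(T has_real_derivative 0) (at z)" if z: "z > 0" for z
  proof -
    define s where "s = sqrt (1 + z\<^sup>2)"
    have s: "s > 0" by (simp add: s_def add_pos_nonneg)
    have di: "((\<lambda>z. 1 / z) has_real_derivative - (1 / z\<^sup>2)) (at z)"
      using z by (auto intro!: derivative_eq_intros simp: power2_eq_square)
    have "1 + (1 / z)\<^sup>2 = (1 + z\<^sup>2) / z\<^sup>2" using z by (simp add: power_divide add_divide_distrib)
    then have si: "sqrt (1 + (1 / z)\<^sup>2) = s / z" using z by (simp add: s_def real_sqrt_divide)
    have "1 / z > 0" using z by simp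
    from DERIV_chain2[OF dH[OF this] di]
    have 1: "((\<lambda>z. ?H (1 / z)) has_real_derivative arsinh (1 / z) / (1 / z * (s / z)) * - (1 / z\<^sup>2)) (at z)"
      unfolding si .
    have 2: "(?H has_real_derivative arsinh z / (z * s)) (at z)"
      using dH[OF z] by (simp add: s_def)
    have 3: "(arsinh has_real_derivative 1 / s) (at z)"
      using arsinh_real_has_field_derivative[of z UNIV] by (simp add: s_def add.commute)
    have 4: "((\<lambda>z. arsinh (1 / z)) has_real_derivative 1 / (s / z) * - (1 / z\<^sup>2)) (at z)"
      using DERIV_chain2[OF arsinh_real_has_field_derivative di] unfolding add.commute[of _ 1] si .
    have "(T has_real_derivative
            arsinh z / (z * s) + arsinh (1 / z) / (1 / z * (s / z)) * - (1 / z\<^sup>2) +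
            (1 / s * arsinh (1 / z) + 1 / (s / z) * - (1 / z\<^sup>2) * arsinh z)) (at z)"
      unfolding T_def[abs_def] by (intro DERIV_add DERIV_mult 1 2 3 4)
    moreover have "arsinh (1 / z) / (1 / z * (s / z)) * - (1 / z\<^sup>2) = - (1 / s * arsinh (1 / z))"
      using z s by (simp add: power2_eq_square)
    moreover have "1 / (s / z) * - (1 / z\<^sup>2) * arsinh z = - (arsinh z / (z * s))"
      using z s by (simp add: power2_eq_square)
    ultimately show ?thesis by simp
  qed
  have const: "T x = T z" if "x > 0" for x
  proof -
    define a b where "a = min x z / 2" and "b = max x z + 1"
    have "a < b" "x \<in> {a<..<b}" "z \<in> {a<..<b}" "a > 0"
      using that assms by (auto simp: a_def b_def min_def max_def)
    then show ?thesis using dT by (intro DERIV_isconst3[of a b x z T]; force)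
  qed
  \<comment> \<open>The constant is read off at infinity: \<open>?H (1 / n)\<close> tends to
    \<open>?H 0 = 0\<close>, and the product term vanishes because arsinh n grows like a logarithm
    while arsinh (1/n) decays like 1/n.\<close>
  have "(\<lambda>n. T (real n)) \<longlonglongrightarrow> pi\<^sup>2 / 4 + ?H 0 + 0"
    unfolding T_def
  proof (intro tendsto_add arctan_sin_integral_at_top)
    have "isCont ?H 0" using arctan_sin_integral_deriv by (rule DERIV_isCont)
    moreover have "(\<lambda>n. 1 / real n) \<longlonglongrightarrow> 0" by real_asymp
    ultimately show "(\<lambda>n. ?H (1 / real n)) \<longlonglongrightarrow> ?H 0" by (rule isCont_tendsto_compose)
    show "(\<lambda>n. arsinh (real n) * arsinh (1 / real n)) \<longlonglongrightarrow> 0"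
      unfolding arsinh_real_def by real_asymp
  qed
  moreover have "(\<lambda>n. T (real n)) \<longlonglongrightarrow> T z"
    by (intro tendsto_eventually eventually_mono[OF eventually_gt_at_top[of 0]]) (simp add: const)
  ultimately have "T z = pi\<^sup>2 / 4 + ?H 0 + 0" by (intro LIMSEQ_unique)
  moreover have "?H 0 = 0" by (simp add: arctan_sin_integral_def)
  ultimately show ?thesis by (simp add: T_def)
qed

text \<open>Substituting x = arctan (sin a) makes the integrand a times the derivative of arctan
  (sin a); partial integration gives pi^2/8 minus \<open>arctan_sin_integral 1\<close>. The
  reflection formula at its fixed point z = 1 evaluates the latter, and the terms pi^2/8
  cancel.\<close>

lemma integral_arcsin_tan:
  "((\<lambda>x. arcsin (tan x)) has_integral (arsinh 1)\<^sup>2 / 2) {0..pi/4}"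
proof -
  define f where "f x = arcsin (tan x)" for x :: real
  define g where "g a = arctan (sin a)" for a :: real
  have contf: "continuous_on {0..pi/4} f"
  proof -
    have "cos x \<noteq> 0 \<and> - 1 \<le> tan x \<and> tan x \<le> 1" if "x \<in> {0..pi/4}" for x
    proof -
      have "0 \<le> x" "x \<le> pi / 4" using that by auto
      then have x: "0 \<le> x" "x \<le> pi / 4" "x < pi / 2" "- (pi / 2) < x" using pi_gt_zero by linarith+
      then have "cos x > 0" by (intro cos_gt_zero_pi) auto
      moreover have "0 \<le> tan x" using x by (intro tan_pos_pi2_le) auto
      moreover have "tan x \<le> tan (pi / 4)" using x by (intro tan_mono_le) auto
      ultimately show ?thesis by (simp add: tan_45)
    qed
    then show ?thesis unfolding f_def[abs_def] by (intro continuous_intros) auto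
  qed
  have dg: "(g has_real_derivative inverse (1 + (sin a)\<^sup>2) * cos a) (at a)" for a
    unfolding g_def[abs_def] by (rule DERIV_chain2[OF DERIV_arctan DERIV_sin])
  have "((\<lambda>a. (inverse (1 + (sin a)\<^sup>2) * cos a) *\<^sub>R f (g a)) has_integral integral {g 0..g (pi/2)} f) {0..pi/2}"
  proof (rule has_integral_substitution[OF _ _ _ contf])
    have "g a \<in> {0..pi/4}" if "a \<in> {0..pi/2}" for a
    proof -
      have "sin a \<ge> 0" using that by (intro sin_ge_zero) auto
      moreover have "arctan (sin a) \<le> arctan 1" by (simp only: arctan_le_iff sin_le_one)
      ultimately show ?thesis by (simp add: g_def arctan_one)
    qed
    then show "g ` {0..pi/2} \<subseteq> {0..pi/4}" by blast
    show "(g has_real_derivative inverse (1 + (sin x)\<^sup>2) * cos x) (at x within {0..pi/2})" for x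
      using dg by (rule DERIV_subset) simp
  qed (auto simp: g_def arctan_one)
  then have 1: "((\<lambda>a. inverse (1 + (sin a)\<^sup>2) * cos a * a) has_integral integral {0..pi/4} f) {0..pi/2}"
  proof (rule has_integral_eq[rotated, THEN has_integral_eq_rhs])
    show "(inverse (1 + (sin a)\<^sup>2) * cos a) *\<^sub>R f (g a) = inverse (1 + (sin a)\<^sup>2) * cos a * a"
      if "a \<in> {0..pi/2}" for a
      using that by (simp add: f_def g_def tan_arctan arcsin_sin)
  qed (auto simp: g_def arctan_one)
  have "((\<lambda>a. arctan (sin a) + inverse (1 + (sin a)\<^sup>2) * cos a * a) has_integral
          (pi/2 * g (pi/2) - 0 * g 0)) {0..pi/2}"
  proof (rule fundamental_theorem_of_calculus)
    show "((\<lambda>a. a * g a) has_vector_derivative arctan (sin a) + inverse (1 + (sin a)\<^sup>2) * cos a * a)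
            (at a within {0..pi/2})" for a
      using DERIV_subset[OF DERIV_mult[OF DERIV_ident dg[of a]], of "{0..pi/2}"]
      by (simp add: has_real_derivative_iff_has_vector_derivative g_def)
  qed simp
  from has_integral_diff[OF this 1]
  have "((\<lambda>a. arctan (sin a)) has_integral pi\<^sup>2 / 8 - integral {0..pi/4} f) {0..pi/2}"
    by (simp add: g_def arctan_one power2_eq_square)
  then have "arctan_sin_integral 1 = pi\<^sup>2 / 8 - integral {0..pi/4} f"
    by (simp add: arctan_sin_integral_def integral_unique)
  moreover have "2 * arctan_sin_integral 1 + (arsinh 1)\<^sup>2 = pi\<^sup>2 / 4"
    using arctan_sin_integral_reflect[of 1] by (simp add: power2_eq_square)
  ultimately have "integral {0..pi/4} f = (arsinh 1)\<^sup>2 / 2" by simp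
  moreover have "f integrable_on {0..pi/4}" using contf by (rule integrable_continuous_real)
  ultimately show ?thesis unfolding f_def by (simp add: has_integral_integrable_integral)
qed

section \<open>The integrals over the single angles\<close>

text \<open>The \<theta>-derivative of the left-hand side is the integral of g' over a full period,
  which vanishes because g is periodic.\<close>

lemma integral_arctan_shift_const:
  fixes k \<theta> :: real
  defines "g \<equiv> \<lambda>t. arctan (k * (1 - cos t) / 2)"
  shows "integral {0..2*pi} (\<lambda>\<phi>. g (\<theta> - \<phi>)) = integral {0..2*pi} g"
proof -
  define g' where "g' t = inverse (1 + (k * (1 - cos t) / 2)\<^sup>2) * (k * sin t / 2)" for t
  have dg: "(g has_real_derivative g' t) (at t)" for t
    unfolding g_def g'_def
    by (rule DERIV_chain2[OF DERIV_arctan]) (auto intro!: derivative_eq_intros)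
  have "1 + (k * (1 - cos t) / 2)\<^sup>2 \<noteq> 0" for t by (smt (verit) zero_le_power2)
  then have contg': "continuous_on A (\<lambda>x. g' (fst x - snd x))" for A
    unfolding g'_def by (intro continuous_intros) auto
  have contg: "continuous_on A (\<lambda>\<phi>. g (\<theta> - \<phi>))" for A \<theta>
    unfolding g_def by (intro continuous_intros) auto
  define W where "W \<theta> = integral {0..2*pi} (\<lambda>\<phi>. g (\<theta> - \<phi>))" for \<theta>
  have dW: "(W has_real_derivative 0) (at \<theta>)" for \<theta>
  proof -
    have "((\<lambda>\<theta>. integral (cbox 0 (2*pi)) (\<lambda>\<phi>. g (\<theta> - \<phi>))) has_real_derivative
            integral (cbox 0 (2*pi)) (\<lambda>\<phi>. g' (\<theta> - \<phi>))) (at \<theta> within UNIV)"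
    proof (rule leibniz_rule_field_derivative)
      show "((\<lambda>\<theta>. g (\<theta> - \<phi>)) has_real_derivative g' (\<theta> - \<phi>)) (at \<theta> within UNIV)" for \<theta> \<phi>
      proof -
        have "((\<lambda>\<theta>. \<theta> - \<phi>) has_real_derivative 1) (at \<theta>)" by (auto intro!: derivative_eq_intros)
        from DERIV_chain2[OF dg this] show ?thesis by simp
      qed
      show "continuous_on (UNIV \<times> cbox 0 (2*pi)) (\<lambda>(\<theta>, \<phi>). g' (\<theta> - \<phi>))"
        unfolding split_beta by (rule contg')
      show "(\<lambda>\<phi>. g (\<theta> - \<phi>)) integrable_on cbox 0 (2*pi)" for \<theta>
        by (intro integrable_continuous contg)
    qed auto
    moreover have "((\<lambda>\<phi>. g' (\<theta> - \<phi>)) has_integral (- g (\<theta> - 2*pi) - - g (\<theta> - 0))) {0..2*pi}"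
    proof (rule fundamental_theorem_of_calculus)
      show "((\<lambda>\<phi>. - g (\<theta> - \<phi>)) has_vector_derivative g' (\<theta> - \<phi>)) (at \<phi> within {0..2*pi})" for \<phi>
      proof -
        have "((\<lambda>\<phi>. \<theta> - \<phi>) has_real_derivative -1) (at \<phi>)" by (auto intro!: derivative_eq_intros)
        from DERIV_subset[OF DERIV_minus[OF DERIV_chain2[OF dg this]], of "{0..2*pi}"]
        show ?thesis by (simp add: has_real_derivative_iff_has_vector_derivative)
      qed
    qed simp
    moreover have "g (\<theta> - 2*pi) = g \<theta>" by (simp add: g_def cos_diff)
    ultimately show ?thesis by (simp add: W_def[abs_def] integral_unique)
  qed
  have "W \<theta> = W 0" using DERIV_isconst_all[of W \<theta> 0] dW by blast
  also have "W 0 = integral {0..2*pi} g" by (simp add: W_def g_def)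
  finally show ?thesis by (simp add: W_def)
qed

text \<open>Halving the angle turns (1 - cos t) / 2 into sin^2 a, and the symmetry a -> pi - a
  leaves four copies of the integral over [0, pi/2].\<close>

lemma integral_arctan_period:
  fixes k \<theta> :: real
  assumes k: "k \<ge> 0"
  shows "((\<lambda>\<phi>. arctan (k * (1 - cos (\<theta> - \<phi>)) / 2)) has_integral
            2 * pi * arcsin (k / (1 + sqrt (1 + k\<^sup>2)))) {0..2*pi}"
proof -
  define g where "g t = arctan (k * (1 - cos t) / 2)" for t
  define h where "h a = arctan (k * (sin a)\<^sup>2)" for a
  have contg: "continuous_on A g" and conth: "continuous_on A h" for A
    unfolding g_def h_def by (intro continuous_intros; auto)+
  have gh: "g (2 * a) = h a" for a
    by (simp add: g_def h_def cos_double_sin)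
  have "((\<lambda>a. 2 *\<^sub>R g (2 * a)) has_integral integral {2 * 0..2 * pi} g) {0..pi}"
    by (rule has_integral_substitution[OF _ _ _ contg[of "{0..2*pi}"]]) (auto intro!: derivative_eq_intros)
  then have 1: "integral {0..2*pi} g = 2 * integral {0..pi} h"
    unfolding gh by (simp add: has_integral_iff)
  have "((\<lambda>a. (-1) *\<^sub>R h (pi - a)) has_integral
      (integral {pi - 0..pi - pi/2} h - integral {pi - pi/2..pi - 0} h)) {0..pi/2}"
    by (rule has_integral_substitution_general[OF finite.emptyI _ _ conth[of "{0..pi}"]])
      (auto intro!: derivative_eq_intros continuous_intros)
  moreover have "h (pi - a) = h a" for a by (simp add: h_def)
  ultimately have "integral {pi/2..pi} h = integral {0..pi/2} h"
    by (simp add: has_integral_iff)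
  moreover have "integral {0..pi/2} h + integral {pi/2..pi} h = integral {0..pi} h"
    using conth by (intro Henstock_Kurzweil_Integration.integral_combine integrable_continuous_real) auto
  ultimately have "integral {0..2*pi} g = 4 * integral {0..pi/2} h" using 1 by simp
  also have "\<dots> = 2 * pi * arcsin (k / (1 + sqrt (1 + k\<^sup>2)))"
    unfolding h_def integral_arctan_sin_sq[OF k] by simp
  finally have "integral {0..2*pi} (\<lambda>\<phi>. g (\<theta> - \<phi>)) = 2 * pi * arcsin (k / (1 + sqrt (1 + k\<^sup>2)))"
    using integral_arctan_shift_const[of k \<theta>] unfolding g_def[abs_def] by (simp only:)
  moreover have "(\<lambda>\<phi>. g (\<theta> - \<phi>)) integrable_on {0..2*pi}"
    unfolding g_def by (intro integrable_continuous_real continuous_intros) auto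
  ultimately show ?thesis by (simp add: has_integral_iff g_def)
qed

text \<open>If |cot \<eta>| = tan b with b = |pi/2 - \<eta>|, this is the half-angle formula for tan
  (b/2).\<close>

lemma cot_half_angle:
  assumes "0 < \<eta>" "\<eta> < pi"
  shows "\<bar>cot \<eta>\<bar> / (1 + sqrt (1 + \<bar>cot \<eta>\<bar>\<^sup>2)) = tan (\<bar>pi/2 - \<eta>\<bar> / 2)"
proof -
  have "arctan \<bar>cot \<eta>\<bar> = \<bar>pi/2 - \<eta>\<bar>"
  proof -
    have "cot \<eta> = tan (pi/2 - \<eta>)" by (simp add: cot_def tan_def sin_diff cos_diff)
    then have "arctan (cot \<eta>) = pi/2 - \<eta>" using assms by (simp add: arctan_tan)
    then show ?thesis by (metis abs_if arctan_less_zero_iff arctan_minus)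
  qed
  then have "\<bar>pi/2 - \<eta>\<bar> / 2 = arctan (\<bar>cot \<eta>\<bar> / (1 + sqrt (1 + \<bar>cot \<eta>\<bar>\<^sup>2)))"
    using arctan_half[of "\<bar>cot \<eta>\<bar>"] by simp
  then show ?thesis by (simp add: tan_arctan)
qed

text \<open>The map \<eta> -> |pi/2 - \<eta>| / 2 covers [0, pi/4] twice, each time at half speed,
  whence four times the value in \<open>integral_arcsin_tan\<close>.\<close>

lemma integral_arcsin_cot:
  "((\<lambda>\<eta>. arcsin (\<bar>cot \<eta>\<bar> / (1 + sqrt (1 + \<bar>cot \<eta>\<bar>\<^sup>2)))) has_integral 2 * (arsinh 1)\<^sup>2) {0..pi}"
proof -
  define f where "f x = arcsin (tan x)" for x :: real
  have f: "(f has_integral (arsinh 1)\<^sup>2 / 2) (cbox 0 (pi/4))"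
    using integral_arcsin_tan by (simp add: f_def[abs_def])
  have "((\<lambda>\<eta>. f (\<bar>pi/2 - \<eta>\<bar> / 2)) has_integral (arsinh 1)\<^sup>2) {0..pi/2}"
  proof (rule has_integral_eq)
    have "(\<lambda>x. (1 / (- (1/2))) *\<^sub>R x + - ((1 / (- (1/2))) *\<^sub>R (pi/4))) ` cbox 0 (pi/4) = {0..pi/2}"
      using image_affinity_cbox[of "-2" "pi/2" 0 "pi/4"] by simp
    then show "((\<lambda>\<eta>. f ((- (1/2)) *\<^sub>R \<eta> + pi/4)) has_integral (arsinh 1)\<^sup>2) {0..pi/2}"
      using has_integral_affinity[OF f, of "- (1/2)" "pi/4"] by simp
    show "f ((- (1/2)) *\<^sub>R \<eta> + pi/4) = f (\<bar>pi/2 - \<eta>\<bar> / 2)" if "\<eta> \<in> {0..pi/2}" for \<eta>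
      using that by (intro arg_cong[of _ _ f]) auto
  qed
  moreover have "((\<lambda>\<eta>. f (\<bar>pi/2 - \<eta>\<bar> / 2)) has_integral (arsinh 1)\<^sup>2) {pi/2..pi}"
  proof (rule has_integral_eq)
    have "(\<lambda>x. (1 / (1/2)) *\<^sub>R x + - ((1 / (1/2)) *\<^sub>R (- (pi/4)))) ` cbox 0 (pi/4) = {pi/2..pi}"
      using image_affinity_cbox[of "2" "pi/2" 0 "pi/4"] by simp
    then show "((\<lambda>\<eta>. f ((1/2) *\<^sub>R \<eta> + - (pi/4))) has_integral (arsinh 1)\<^sup>2) {pi/2..pi}"
      using has_integral_affinity[OF f, of "1/2" "- (pi/4)"] by simp
    show "f ((1/2) *\<^sub>R \<eta> + - (pi/4)) = f (\<bar>pi/2 - \<eta>\<bar> / 2)" if "\<eta> \<in> {pi/2..pi}" for \<eta>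
      using that by (intro arg_cong[of _ _ f]) auto
  qed
  ultimately have "((\<lambda>\<eta>. f (\<bar>pi/2 - \<eta>\<bar> / 2)) has_integral (arsinh 1)\<^sup>2 + (arsinh 1)\<^sup>2) {0..pi}"
    by (intro has_integral_combine[of 0 "pi/2" pi]) auto
  then have "((\<lambda>\<eta>. arcsin (\<bar>cot \<eta>\<bar> / (1 + sqrt (1 + \<bar>cot \<eta>\<bar>\<^sup>2)))) has_integral (arsinh 1)\<^sup>2 + (arsinh 1)\<^sup>2) {0..pi}"
  \<comment> \<open>At 0 and pi the default \<open>cot = 0\<close> gives arcsin 0 instead of arcsin
    1, so the two points are excluded.\<close>
  proof (rule has_integral_spike_finite[of "{0, pi}", rotated 2])
    show "arcsin (\<bar>cot \<eta>\<bar> / (1 + sqrt (1 + \<bar>cot \<eta>\<bar>\<^sup>2))) = f (\<bar>pi/2 - \<eta>\<bar> / 2)"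
      if "\<eta> \<in> {0..pi} - {0, pi}" for \<eta>
      using cot_half_angle[of \<eta>] that by (auto simp: f_def)
  qed simp
  then show ?thesis by simp
qed

text \<open>On (0, pi/2) the condition reads tan \<zeta> \<le> k/2, and |cot| is symmetric about
  pi/2. The favourable \<zeta> thus fill two end intervals of length arctan (k/2).\<close>

lemma mult_abs_cot_ge_2_iff:
  assumes k: "k \<ge> 0" and z: "0 < \<zeta>" "\<zeta> < pi"
  shows "2 \<le> k * \<bar>cot \<zeta>\<bar> \<longleftrightarrow> \<zeta> \<le> arctan (k/2) \<or> pi - arctan (k/2) \<le> \<zeta>"
proof -
  have half: "2 \<le> k * \<bar>cot \<zeta>\<bar> \<longleftrightarrow> \<zeta> \<le> arctan (k/2)" if "0 < \<zeta>" "\<zeta> < pi/2" for \<zeta>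
  proof -
    have s: "sin \<zeta> > 0" "cos \<zeta> > 0" using that by (auto intro: sin_gt_zero cos_gt_zero)
    then have t: "tan \<zeta> > 0" by (simp add: tan_def)
    have "\<bar>cot \<zeta>\<bar> = 1 / tan \<zeta>" using s by (simp add: cot_def tan_def)
    then have "2 \<le> k * \<bar>cot \<zeta>\<bar> \<longleftrightarrow> tan \<zeta> \<le> k / 2" using t by (simp add: pos_le_divide_eq mult.commute)
    also have "\<dots> \<longleftrightarrow> arctan (tan \<zeta>) \<le> arctan (k / 2)" by (simp only: arctan_le_iff)
    finally show ?thesis using that by (simp add: arctan_tan)
  qed
  have a: "arctan (k/2) < pi/2" by (rule arctan_ubound)
  consider "\<zeta> < pi/2" | "\<zeta> = pi/2" | "\<zeta> > pi/2" by linarith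
  then show ?thesis
  proof cases
    case 1
    then show ?thesis using half[of \<zeta>] z a by auto
  next
    case 2
    have "cot (pi/2 :: real) = 0" by (simp add: cot_def)
    then show ?thesis using a unfolding 2 by simp
  next
    case 3
    have "\<bar>cot (pi - \<zeta>)\<bar> = \<bar>cot \<zeta>\<bar>" by (simp add: cot_def)
    then show ?thesis using half[of "pi - \<zeta>"] 3 z a by auto
  qed
qed

section \<open>Discreteness\<close>

lemma carrier_SL2C: "carrier SL2C = {A. det A = 1}"
  by (simp add: SL2C_def)

lemma pm_class_mult:
  assumes "det A = 1" "det B = 1"
  shows "pm_class A \<otimes>\<^bsub>PSL2C\<^esub> pm_class B = pm_class (A ** B)"
  using normal.rcos_sum[OF normal_pm, of A B] assms by (simp add: PSL2C_def pm_class_def SL2C_def)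

lemma pm_class_one: "\<one>\<^bsub>PSL2C\<^esub> = pm_class (mat 1)"
  by (auto simp: PSL2C_def pm_class_eq)

lemma pm_class_in_carrier: "det A = 1 \<Longrightarrow> pm_class A \<in> carrier PSL2C"
  by (simp add: carrier_PSL2C carrier_SL2C)

lemma pm_class_eq_iff: "pm_class A = pm_class B \<longleftrightarrow> A = B \<or> A = - B"
  by (auto simp: pm_class_eq doubleton_eq_iff)

lemma continuous_on_matrix_mult [continuous_intros]:
  fixes f g :: "'a::topological_space \<Rightarrow> complex ^ 2 ^ 2"
  assumes "continuous_on S f" "continuous_on S g"
  shows "continuous_on S (\<lambda>x. f x ** g x)"
  unfolding matrix_matrix_mult_def using assms
  by (intro continuous_intros continuous_on_vec_lambda)

text \<open>Invariance under sign makes the set of matrices saturated, so it is the full preimage of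
  its image under the quotient map.\<close>

lemma openin_pm_class_image:
  assumes sym: "\<And>A. Q (- A) = Q A" and op: "open {A. Q A}"
  shows "openin PSL2C_topology (pm_class ` {A \<in> carrier SL2C. Q A})"
proof -
  have "{A \<in> carrier SL2C. pm_class A \<in> pm_class ` {A \<in> carrier SL2C. Q A}} = carrier SL2C \<inter> {A. Q A}"
    using sym by (auto simp: pm_class_eq_iff)
  moreover have "openin (top_of_set (carrier SL2C)) (carrier SL2C \<inter> {A. Q A})"
    using op by (rule openin_open_Int)
  moreover have "pm_class ` {A \<in> carrier SL2C. Q A} \<subseteq> topspace PSL2C_topology"
    by (auto simp: carrier_PSL2C topspace_PSL2C_topology)
  from conjunct2[OF quotient_map_pm_class[unfolded quotient_map_def], rule_format, OF this]
  have "openin (top_of_set (carrier SL2C)) {A \<in> carrier SL2C. pm_class A \<in> pm_class ` {A \<in> carrier SL2C. Q A}}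
      \<longleftrightarrow> openin PSL2C_topology (pm_class ` {A \<in> carrier SL2C. Q A})"
    by (simp only: topspace_euclidean_subtopology)
  ultimately show ?thesis by (simp only:)
qed

text \<open>Left translation carries isolation of the identity to every other point. Both matrices
  of a coset are tested, since A and - A have the same class and A ranges over all matrices of
  determinant 1.\<close>

lemma discrete_in_PSL2C_iff:
  assumes sub: "subgroup \<Gamma> PSL2C"
  shows "discrete_in_PSL2C \<Gamma> \<longleftrightarrow>
    (\<exists>e>0. \<forall>A. det A = 1 \<longrightarrow> pm_class A \<in> \<Gamma> \<longrightarrow> A = mat 1 \<or> A = - mat 1 \<or> e \<le> dist A (mat 1))"
proof
  interpret group PSL2C by (rule group_PSL2C)
  interpret subgroup \<Gamma> PSL2C by (rule sub)
  have one: "pm_class (mat 1) \<in> \<Gamma>" using one_closed by (simp add: pm_class_one)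
  {
    assume "discrete_in_PSL2C \<Gamma>"
    then have "openin (subtopology PSL2C_topology \<Gamma>) {pm_class (mat 1)}"
      using one by (simp add: discrete_in_PSL2C_def)
    then obtain U where U: "openin PSL2C_topology U" "{pm_class (mat 1)} = U \<inter> \<Gamma>"
      by (auto simp: openin_subtopology)
    have "U \<subseteq> carrier PSL2C" using U(1) by (simp add: openin_PSL2C_topology)
    then have "openin (top_of_set (carrier SL2C)) {A \<in> carrier SL2C. pm_class A \<in> U}"
      using U(1) by (simp add: openin_PSL2C_topology Union_preimage_pm_class)
    then obtain T where T: "open T" "{A \<in> carrier SL2C. pm_class A \<in> U} = carrier SL2C \<inter> T"
      by (auto simp: openin_open)
    have "mat 1 \<in> carrier SL2C \<inter> T" using U(2) unfolding T(2)[symmetric] by (auto simp: carrier_SL2C)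
    then obtain e where e: "e > 0" "ball (mat 1) e \<subseteq> T" using T(1) by (auto simp: open_contains_ball)
    have "A = mat 1 \<or> A = - mat 1 \<or> e \<le> dist A (mat 1)" if A: "det A = 1" "pm_class A \<in> \<Gamma>" for A
    proof (cases "dist A (mat 1) < e")
      case True
      then have "A \<in> carrier SL2C \<inter> T" using e A by (auto simp: carrier_SL2C dist_commute)
      then have "pm_class A \<in> U" unfolding T(2)[symmetric] by simp
      then have "pm_class A = pm_class (mat 1)" using U(2) A(2) by blast
      then show ?thesis by (auto simp: pm_class_eq_iff)
    qed simp
    then show "\<exists>e>0. \<forall>A. det A = 1 \<longrightarrow> pm_class A \<in> \<Gamma> \<longrightarrow> A = mat 1 \<or> A = - mat 1 \<or> e \<le> dist A (mat 1)"
      using e(1) by blast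
  next
    assume "\<exists>e>0. \<forall>A. det A = 1 \<longrightarrow> pm_class A \<in> \<Gamma> \<longrightarrow> A = mat 1 \<or> A = - mat 1 \<or> e \<le> dist A (mat 1)"
    then obtain e where e: "e > 0"
      "\<And>A. det A = 1 \<Longrightarrow> pm_class A \<in> \<Gamma> \<Longrightarrow> dist A (mat 1) < e \<Longrightarrow> A = mat 1 \<or> A = - mat 1"
      by (meson not_le)
    have sing: "openin (subtopology PSL2C_topology \<Gamma>) {X}" if X: "X \<in> \<Gamma>" for X
    proof -
      obtain B where B: "X = pm_class B" "det B = 1"
        using X subset by (auto simp: carrier_PSL2C carrier_SL2C)
      obtain C where C: "inv\<^bsub>PSL2C\<^esub> X = pm_class C" "det C = 1"
        using inv_closed[of X] X subset by (auto simp: carrier_PSL2C carrier_SL2C)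
      \<comment> \<open>The translate of the e-ball about the identity, symmetrised under sign so
        that it descends to an open set of cosets.\<close>
      define Q where "Q A \<longleftrightarrow> dist (C ** A) (mat 1) < e \<or> dist (- (C ** A)) (mat 1) < e" for A
      have "C ** B = mat 1 \<or> C ** B = - mat 1"
      proof -
        have "pm_class C \<otimes>\<^bsub>PSL2C\<^esub> pm_class B = \<one>\<^bsub>PSL2C\<^esub>"
          using l_inv[of X] X subset unfolding C(1)[symmetric] B(1)[symmetric] by blast
        then show ?thesis using B(2) C(2) by (simp add: pm_class_mult pm_class_one pm_class_eq_iff)
      qed
      then have QB: "Q B" using e(1) by (auto simp: Q_def)
      have "open {A. Q A}" unfolding Q_def
        by (intro open_Collect_disj open_Collect_less continuous_intros)
      then have "openin PSL2C_topology (pm_class ` {A \<in> carrier SL2C. Q A})"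
        by (intro openin_pm_class_image) (auto simp: Q_def uminus_matrix_mul)
      moreover have "pm_class ` {A \<in> carrier SL2C. Q A} \<inter> \<Gamma> = {X}"
      proof -
        have "pm_class A = X" if A: "det A = 1" "Q A" "pm_class A \<in> \<Gamma>" for A
        proof -
          have "pm_class C \<otimes>\<^bsub>PSL2C\<^esub> pm_class A \<in> \<Gamma>"
            unfolding C(1)[symmetric] using X A(3) by (intro m_closed m_inv_closed)
          then have CA: "pm_class (C ** A) \<in> \<Gamma>" "det (C ** A) = 1"
            using A(1) C(2) by (simp_all add: pm_class_mult det_mul)
          have neg: "pm_class (- (C ** A)) = pm_class (C ** A)" "det (- (C ** A)) = 1"
            using CA(2) by (simp_all add: pm_class_eq_iff det_uminus2)
          have "C ** A = - mat 1" if "- (C ** A) = mat 1"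
            using that by (metis minus_minus)
          then have "pm_class (C ** A) = pm_class (mat 1)"
            using A(2) e(2)[OF CA(2,1)] e(2)[of "- (C ** A)"] CA neg
            by (auto simp: Q_def pm_class_eq_iff)
          then have "inv\<^bsub>PSL2C\<^esub> X \<otimes>\<^bsub>PSL2C\<^esub> pm_class A = \<one>\<^bsub>PSL2C\<^esub>"
            using A(1) C by (simp add: pm_class_mult pm_class_one)
          moreover have "X \<in> carrier PSL2C" using X subset by blast
          ultimately have "inv\<^bsub>PSL2C\<^esub> (pm_class A) = inv\<^bsub>PSL2C\<^esub> X"
            using pm_class_in_carrier[OF A(1)] by (intro inv_equality) auto
          then show ?thesis
            using pm_class_in_carrier[OF A(1)] \<open>X \<in> carrier PSL2C\<close> by (metis inv_inv)
        qed
        moreover have "X \<in> pm_class ` {A \<in> carrier SL2C. Q A}"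
          using B QB by (auto simp: carrier_SL2C)
        ultimately show ?thesis using X by (auto simp: carrier_SL2C)
      qed
      ultimately show ?thesis by (auto simp: openin_subtopology)
    qed
    have "topspace (subtopology PSL2C_topology \<Gamma>) = \<Gamma>"
      using subset by (auto simp: topspace_PSL2C_topology)
    then show "discrete_in_PSL2C \<Gamma>"
      using sing unfolding discrete_in_PSL2C_def by (metis discrete_topology_unique)
  }
qed

section \<open>Parabolic matrices and words in two of them\<close>

definition par_mat :: "real \<Rightarrow> real \<Rightarrow> complex ^ 2 ^ 2" where
  "par_mat x \<theta> = mat2 (1 + \<i> * of_real x) (of_real x * cis \<theta>)
     (of_real x * cis (- \<theta>)) (1 - \<i> * of_real x)"

lemma parabolic_elt_eq: "parabolic_elt x \<theta> = pm_class (par_mat x \<theta>)"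
  by (simp add: parabolic_elt_def par_mat_def)

lemma mat2_nth [simp]:
  "mat2 a b c d $ 1 $ 1 = a" "mat2 a b c d $ 1 $ 2 = b"
  "mat2 a b c d $ 2 $ 1 = c" "mat2 a b c d $ 2 $ 2 = d"
  by (simp_all add: mat2_def)

lemma mat1_nth [simp]:
  "(mat 1 :: complex ^ 2 ^ 2) $ 1 $ 1 = 1" "(mat 1 :: complex ^ 2 ^ 2) $ 1 $ 2 = 0"
  "(mat 1 :: complex ^ 2 ^ 2) $ 2 $ 1 = 0" "(mat 1 :: complex ^ 2 ^ 2) $ 2 $ 2 = 1"
  by (simp_all add: mat_def)

lemma matrix2_eq_iff:
  "A = B \<longleftrightarrow> A $ 1 $ 1 = B $ 1 $ 1 \<and> A $ 1 $ 2 = B $ 1 $ 2 \<and> A $ 2 $ 1 = B $ 2 $ 1 \<and> A $ 2 $ 2 = B $ 2 $ 2"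
  for A B :: "complex ^ 2 ^ 2"
  by (auto simp: vec_eq_iff forall_2)

lemma matrix2_mult_nth: "(A ** B) $ i $ j = A $ i $ 1 * B $ 1 $ j + A $ i $ 2 * B $ 2 $ j"
  for A B :: "complex ^ 2 ^ 2"
  by (simp add: matrix_matrix_mult_def sum_2)

lemma det_par_mat: "det (par_mat x \<theta>) = 1"
  by (simp add: par_mat_def det_mat2 algebra_simps cis_mult)

lemma par_mat_0: "par_mat 0 \<theta> = mat 1"
  by (simp add: matrix2_eq_iff par_mat_def)

lemma par_mat_mult: "par_mat x \<theta> ** par_mat y \<theta> = par_mat (x + y) \<theta>"
  by (simp add: matrix2_eq_iff matrix2_mult_nth par_mat_def algebra_simps cis_mult)

lemma parabolic_elt_mult:
  "parabolic_elt x \<theta> \<otimes>\<^bsub>PSL2C\<^esub> parabolic_elt y \<theta> = parabolic_elt (x + y) \<theta>"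
  by (simp add: parabolic_elt_eq pm_class_mult det_par_mat par_mat_mult)

lemma parabolic_elt_0: "parabolic_elt 0 \<theta> = \<one>\<^bsub>PSL2C\<^esub>"
  by (simp add: parabolic_elt_eq par_mat_0 pm_class_one)

lemma parabolic_elt_in_PSL2C: "parabolic_elt x \<theta> \<in> carrier PSL2C"
  by (simp add: parabolic_elt_eq pm_class_in_carrier det_par_mat)

lemma inv_parabolic_elt: "inv\<^bsub>PSL2C\<^esub> (parabolic_elt x \<theta>) = parabolic_elt (- x) \<theta>"
  by (rule group.inv_equality[OF group_PSL2C])
    (simp_all add: parabolic_elt_mult parabolic_elt_0 parabolic_elt_in_PSL2C)

text \<open>A word is a list of powers; the flag selects one of the two one-parameter groups.\<close>

definition letter :: "real \<Rightarrow> real \<Rightarrow> real \<Rightarrow> real \<Rightarrow> bool \<Rightarrow> int \<Rightarrow> complex ^ 2 ^ 2" where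
  "letter x \<theta> y \<phi> b m = (if b then par_mat (of_int m * x) \<theta> else par_mat (of_int m * y) \<phi>)"

primrec word_mat :: "real \<Rightarrow> real \<Rightarrow> real \<Rightarrow> real \<Rightarrow> (bool \<times> int) list \<Rightarrow> complex ^ 2 ^ 2" where
  "word_mat x \<theta> y \<phi> [] = mat 1"
| "word_mat x \<theta> y \<phi> (l # w) = letter x \<theta> y \<phi> (fst l) (snd l) ** word_mat x \<theta> y \<phi> w"

lemma det_letter: "det (letter x \<theta> y \<phi> b m) = 1"
  by (simp add: letter_def det_par_mat)

lemma letter_0: "letter x \<theta> y \<phi> b 0 = mat 1"
  by (simp add: letter_def par_mat_0)

lemma letter_mult: "letter x \<theta> y \<phi> b m ** letter x \<theta> y \<phi> b n = letter x \<theta> y \<phi> b (m + n)"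
  by (simp add: letter_def par_mat_mult distrib_right)

lemma det_word_mat: "det (word_mat x \<theta> y \<phi> w) = 1"
  by (induction w) (simp_all add: det_mul det_letter)

lemma word_mat_append: "word_mat x \<theta> y \<phi> (v @ w) = word_mat x \<theta> y \<phi> v ** word_mat x \<theta> y \<phi> w"
  by (induction v) (simp_all add: matrix_mul_assoc)

lemma
  shows subgroup_generate_parabolic: "subgroup (generate disc_group {parabolic_elt x \<theta>, parabolic_elt y \<phi>}) PSL2C"
    and generate_parabolic_PSL2C: "generate disc_group {parabolic_elt x \<theta>, parabolic_elt y \<phi>} =
      generate PSL2C {parabolic_elt x \<theta>, parabolic_elt y \<phi>}"
proof -
  have "disc_group = PSL2C\<lparr>carrier := carrier disc_group\<rparr>" by (simp add: disc_group_def)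
  then show eq: "generate disc_group {parabolic_elt x \<theta>, parabolic_elt y \<phi>} =
      generate PSL2C {parabolic_elt x \<theta>, parabolic_elt y \<phi>}"
    using group.generate_consistent[OF group_PSL2C _ subgroup_disc_group,
        of "{parabolic_elt x \<theta>, parabolic_elt y \<phi>}"] parabolic_elt_in_disc_group by simp
  show "subgroup (generate disc_group {parabolic_elt x \<theta>, parabolic_elt y \<phi>}) PSL2C"
    unfolding eq by (rule group.generate_is_subgroup[OF group_PSL2C]) (simp add: parabolic_elt_in_PSL2C)
qed

lemma subgroup_parabolic_powers:
  assumes "subgroup H PSL2C" and x: "parabolic_elt x \<theta> \<in> H"
  shows "parabolic_elt (of_int m * x) \<theta> \<in> H"
proof -
  interpret subgroup H PSL2C by fact
  have mx: "parabolic_elt (- x) \<theta> \<in> H"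
    using m_inv_closed[OF x] by (simp add: inv_parabolic_elt)
  show ?thesis
  proof (induction m rule: int_induct[of _ 0])
    case base
    then show ?case using one_closed by (simp add: parabolic_elt_0)
  next
    case (step1 i)
    then show ?case using m_closed[OF _ x, of "parabolic_elt (of_int i * x) \<theta>"]
      by (simp add: parabolic_elt_mult distrib_right)
  next
    case (step2 i)
    then show ?case using m_closed[OF _ mx, of "parabolic_elt (of_int i * x) \<theta>"]
      by (simp add: parabolic_elt_mult left_diff_distrib)
  qed
qed

lemma generate_parabolic_eq_words:
  "generate disc_group {parabolic_elt x \<theta>, parabolic_elt y \<phi>} = range (\<lambda>w. pm_class (word_mat x \<theta> y \<phi> w))"
  (is "?G = range ?W")
proof
  have word: "pm_class (letter x \<theta> y \<phi> b m) = ?W [(b, m)]" for b m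
    by simp
  show "?G \<subseteq> range ?W"
  proof
    fix h assume "h \<in> ?G"
    then have "h \<in> generate PSL2C {parabolic_elt x \<theta>, parabolic_elt y \<phi>}"
      by (simp only: generate_parabolic_PSL2C)
    then show "h \<in> range ?W"
    proof (induction rule: generate.induct)
      case one
      have "\<one>\<^bsub>PSL2C\<^esub> = ?W []" by (simp add: pm_class_one)
      then show ?case by blast
    next
      case (incl h)
      then have "h = ?W [(True, 1)] \<or> h = ?W [(False, 1)]"
        by (auto simp: parabolic_elt_eq letter_def)
      then show ?case by blast
    next
      case (inv h)
      then have "inv\<^bsub>PSL2C\<^esub> h = ?W [(True, -1)] \<or> inv\<^bsub>PSL2C\<^esub> h = ?W [(False, -1)]"
        by (auto simp: inv_parabolic_elt letter_def) (auto simp: parabolic_elt_eq)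
      then show ?case by blast
    next
      case (eng h1 h2)
      then obtain v w where "h1 = ?W v" "h2 = ?W w" by blast
      then have "h1 \<otimes>\<^bsub>PSL2C\<^esub> h2 = ?W (v @ w)"
        by (simp add: pm_class_mult det_word_mat word_mat_append)
      then show ?case by blast
    qed
  qed
  interpret subgroup ?G PSL2C by (rule subgroup_generate_parabolic)
  have gens: "parabolic_elt x \<theta> \<in> ?G" "parabolic_elt y \<phi> \<in> ?G" by (auto intro: generate.incl)
  have letters: "pm_class (letter x \<theta> y \<phi> b m) \<in> ?G" for b m
    using subgroup_parabolic_powers[OF subgroup_axioms gens(1)] subgroup_parabolic_powers[OF subgroup_axioms gens(2)]
    by (simp add: letter_def parabolic_elt_eq)
  have "?W w \<in> ?G" for w
  proof (induction w)
    case Nil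
    then show ?case using one_closed by (simp add: pm_class_one)
  next
    case (Cons l w)
    then show ?case using m_closed[OF letters[of "fst l" "snd l"] Cons]
      by (simp add: pm_class_mult det_letter det_word_mat)
  qed
  then show "range ?W \<subseteq> ?G" by blast
qed

text \<open>Symmetric under A -> - A, so that it does not matter which matrix of its coset a word
  produces. It is built from equalities and weak inequalities and hence closed in A, which serves
  measurability.\<close>

definition "far_from_one e A \<longleftrightarrow>
  A = mat 1 \<or> A = - mat 1 \<or> e \<le> dist A (mat 1) \<and> e \<le> dist (- A) (mat 1)"
  for A :: "complex ^ 2 ^ 2"

text \<open>Both quantifiers range over countable types: the radius is taken among 1 / (n + 1), and
  words are lists over a countable alphabet.\<close>

lemma discrete_iff_words:
  "discrete_in_PSL2C (generate disc_group {parabolic_elt x \<theta>, parabolic_elt y \<phi>}) \<longleftrightarrow>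
   (\<exists>n. \<forall>w. far_from_one (1 / real (Suc n)) (word_mat x \<theta> y \<phi> w))"
proof -
  have *: "(\<forall>A. det A = 1 \<longrightarrow> pm_class A \<in> range (\<lambda>w. pm_class (word_mat x \<theta> y \<phi> w)) \<longrightarrow>
       A = mat 1 \<or> A = - mat 1 \<or> e \<le> dist A (mat 1)) \<longleftrightarrow>
     (\<forall>w. far_from_one e (word_mat x \<theta> y \<phi> w))" (is "?L e \<longleftrightarrow> ?R e") for e
  proof
    assume L: "?L e"
    have "far_from_one e (word_mat x \<theta> y \<phi> w)" for w
    proof -
      let ?A = "word_mat x \<theta> y \<phi> w"
      have "pm_class (- ?A) = pm_class ?A" by (simp add: pm_class_eq_iff)
      then have "pm_class (- ?A) \<in> range (\<lambda>w. pm_class (word_mat x \<theta> y \<phi> w))" by blast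
      then have "- ?A = mat 1 \<or> - ?A = - mat 1 \<or> e \<le> dist (- ?A) (mat 1)"
        using L[rule_format, of "- ?A"] by (simp add: det_uminus2 det_word_mat)
      moreover have "?A = mat 1 \<or> ?A = - mat 1 \<or> e \<le> dist ?A (mat 1)"
        using L by (simp add: det_word_mat)
      moreover have "- ?A = mat 1 \<Longrightarrow> ?A = - mat 1" by (metis minus_minus)
      ultimately show ?thesis unfolding far_from_one_def by auto
    qed
    then show "?R e" by blast
  next
    assume R: "?R e"
    show "?L e"
    proof (intro allI impI)
      fix A :: "complex ^ 2 ^ 2"
      assume "pm_class A \<in> range (\<lambda>w. pm_class (word_mat x \<theta> y \<phi> w))"
      then obtain w where "A = word_mat x \<theta> y \<phi> w \<or> A = - word_mat x \<theta> y \<phi> w"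
        by (auto simp: pm_class_eq_iff)
      then show "A = mat 1 \<or> A = - mat 1 \<or> e \<le> dist A (mat 1)"
        using R[rule_format, of w] by (auto simp: far_from_one_def)
    qed
  qed
  have mono: "far_from_one e A" if "far_from_one d A" "e \<le> d" for d e A
    using that by (auto simp: far_from_one_def)
  have "(\<exists>e>0. ?R e) \<longleftrightarrow> (\<exists>n. ?R (1 / real (Suc n)))"
  proof
    assume "\<exists>e>0. ?R e"
    then obtain e where e: "e > 0" "?R e" by blast
    then obtain n where "1 / real (Suc n) < e" using nat_approx_posE by blast
    then show "\<exists>n. ?R (1 / real (Suc n))" using e(2) mono by (meson less_imp_le)
  next
    assume "\<exists>n. ?R (1 / real (Suc n))"
    then show "\<exists>e>0. ?R e" by (metis zero_less_divide_1_iff of_nat_0_less_iff zero_less_Suc)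
  qed
  then show ?thesis
    unfolding discrete_in_PSL2C_iff[OF subgroup_generate_parabolic]
    unfolding generate_parabolic_eq_words * .
qed

section \<open>Ping-pong for two parabolic elements\<close>

text \<open>\<open>par_mat x \<theta>\<close> is the identity plus x times a nilpotent matrix of
  rank one, namely the column \<open>fix_vec \<theta>\<close> times the linear form
  \<open>fix_form \<theta>\<close>. The vector is the eigenvector over the fixed point \<i> cis
  \<theta> on the unit circle, the same for all x.\<close>

definition fix_vec :: "real \<Rightarrow> complex ^ 2" where
  "fix_vec \<theta> = vector [\<i>, cis (- \<theta>)]"

definition fix_form :: "real \<Rightarrow> complex ^ 2 \<Rightarrow> complex" where
  "fix_form \<theta> u = u $ 1 - \<i> * cis \<theta> * u $ 2"

lemma par_mat_action: "par_mat x \<theta> *v u = u + (of_real x * fix_form \<theta> u) *s fix_vec \<theta>"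
  by (simp add: vec_eq_iff forall_2 matrix_vector_mult_def sum_2 fix_form_def fix_vec_def
      algebra_simps cis_mult par_mat_def)

lemma fix_form_add: "fix_form \<theta> (u + v) = fix_form \<theta> u + fix_form \<theta> v"
  by (simp add: fix_form_def algebra_simps)

lemma fix_form_scale: "fix_form \<theta> (c *s u) = c * fix_form \<theta> u"
  by (simp add: fix_form_def algebra_simps)

lemma fix_form_minus: "fix_form \<theta> (- u) = - fix_form \<theta> u"
  by (simp add: fix_form_def algebra_simps)

lemma fix_form_fix_vec: "fix_form \<theta> (fix_vec \<phi>) = \<i> * (1 - cis (\<theta> - \<phi>))"
  by (simp add: fix_form_def fix_vec_def algebra_simps cis_mult)

lemma cmod_fix_form_fix_vec: "cmod (fix_form \<theta> (fix_vec \<phi>)) = sqrt (2 * (1 - cos (\<theta> - \<phi>)))"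
proof -
  have "(1 - cos t)\<^sup>2 + (sin t)\<^sup>2 = 2 * (1 - cos t)" for t :: real
    by (simp add: sin_squared_eq) (simp add: power2_eq_square algebra_simps)
  then show ?thesis
    unfolding fix_form_fix_vec norm_mult by (simp add: cmod_def)
qed

lemma fix_form_par_mat_same: "fix_form \<theta> (par_mat x \<theta> *v u) = fix_form \<theta> u"
  by (simp add: par_mat_action fix_form_add fix_form_scale fix_form_fix_vec)

text \<open>A letter adds a multiple of its fixed vector; the bound is the reverse triangle
  inequality for the form of the other generator.\<close>

lemma cmod_fix_form_par_mat:
  "cmod (fix_form \<phi> (par_mat x \<theta> *v u))
     \<ge> \<bar>x\<bar> * sqrt (2 * (1 - cos (\<theta> - \<phi>))) * cmod (fix_form \<theta> u) - cmod (fix_form \<phi> u)"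
proof -
  have "\<bar>x\<bar> * sqrt (2 * (1 - cos (\<theta> - \<phi>))) * cmod (fix_form \<theta> u) =
        cmod (of_real x * fix_form \<theta> u * fix_form \<phi> (fix_vec \<theta>))"
    using cos_minus[of "\<theta> - \<phi>"] by (simp add: norm_mult cmod_fix_form_fix_vec)
  also have "\<dots> \<le> cmod (fix_form \<phi> (par_mat x \<theta> *v u)) + cmod (fix_form \<phi> u)"
    using norm_triangle_ineq4[of "fix_form \<phi> (par_mat x \<theta> *v u)" "fix_form \<phi> u"]
    by (simp add: par_mat_action fix_form_add fix_form_scale)
  finally show ?thesis by simp
qed

text \<open>The flag records the leftmost letter, the one applied last; neighbouring letters
  alternate and no power is trivial.\<close>

inductive reduced_word :: "real \<Rightarrow> real \<Rightarrow> real \<Rightarrow> real \<Rightarrow> bool \<Rightarrow> complex ^ 2 ^ 2 \<Rightarrow> bool"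
  for x \<theta> y \<phi> where
  single: "m \<noteq> 0 \<Longrightarrow> reduced_word x \<theta> y \<phi> b (letter x \<theta> y \<phi> b m)"
| step: "m \<noteq> 0 \<Longrightarrow> reduced_word x \<theta> y \<phi> (\<not> b) A \<Longrightarrow> reduced_word x \<theta> y \<phi> b (letter x \<theta> y \<phi> b m ** A)"

text \<open>The new letter merges with the leftmost one. If the powers cancel, what remains is
  either empty or a reduced word with the other flag.\<close>

lemma reduced_word_letter_mult:
  assumes "reduced_word x \<theta> y \<phi> b A"
  shows "letter x \<theta> y \<phi> b m ** A = mat 1 \<or> (\<exists>c. reduced_word x \<theta> y \<phi> c (letter x \<theta> y \<phi> b m ** A))"
  using assms
proof cases
  case (single n)
  show ?thesis
  proof (cases "m + n = 0")
    case True
    then show ?thesis using single by (simp add: letter_mult letter_0)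
  next
    case False
    from reduced_word.single[OF this, of x \<theta> y \<phi> b] show ?thesis using single by (auto simp: letter_mult)
  qed
next
  case (step n B)
  have eq: "letter x \<theta> y \<phi> b m ** A = letter x \<theta> y \<phi> b (m + n) ** B"
    unfolding step by (simp add: matrix_mul_assoc letter_mult)
  show ?thesis
  proof (cases "m + n = 0")
    case True
    then have "letter x \<theta> y \<phi> b m ** A = B" unfolding eq by (simp add: letter_0)
    then show ?thesis using step by blast
  next
    case False
    from reduced_word.step[OF this step(3)] show ?thesis unfolding eq by blast
  qed
qed

lemma word_mat_reduced:
  "word_mat x \<theta> y \<phi> w = mat 1 \<or> (\<exists>b. reduced_word x \<theta> y \<phi> b (word_mat x \<theta> y \<phi> w))"
proof (induction w)
  case (Cons l w)
  obtain b m where l: "l = (b, m)" by (cases l)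
  show ?case
  proof (cases "m = 0")
    case True
    then show ?thesis using Cons by (simp add: l letter_0)
  next
    case m: False
    have "reduced_word x \<theta> y \<phi> b A \<or> reduced_word x \<theta> y \<phi> (\<not> b) A" if "reduced_word x \<theta> y \<phi> c A" for c A
      using that by (cases b; cases c) auto
    then consider "word_mat x \<theta> y \<phi> w = mat 1"
      | "reduced_word x \<theta> y \<phi> b (word_mat x \<theta> y \<phi> w)"
      | "reduced_word x \<theta> y \<phi> (\<not> b) (word_mat x \<theta> y \<phi> w)"
      using Cons by blast
    then show ?thesis
    proof cases
      case 1
      then show ?thesis using reduced_word.single[OF m, of x \<theta> y \<phi> b] by (auto simp: l)
    next
      case 2
      then show ?thesis using reduced_word_letter_mult[of x \<theta> y \<phi> b] by (simp add: l)
    next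
      case 3
      then show ?thesis using reduced_word.step[OF m 3] by (auto simp: l)
    qed
  qed
qed simp

text \<open>Ping-pong in the coordinates \<open>fix_form \<theta>\<close>, \<open>fix_form \<phi>\<close>: the letter applied last
  dominates, and sizes never drop below twice the size of the starting vector. The weight
  \<open>s\<close> balances the two translation lengths.\<close>

lemma discrete_if_large:
  assumes large: "\<bar>x * y\<bar> * (1 - cos (\<theta> - \<phi>)) \<ge> 2"
  shows "discrete_in_PSL2C (generate disc_group {parabolic_elt x \<theta>, parabolic_elt y \<phi>})"
proof -
  define d where "d = sqrt (2 * (1 - cos (\<theta> - \<phi>)))"
  have xy: "x \<noteq> 0" "y \<noteq> 0" and "1 - cos (\<theta> - \<phi>) \<noteq> 0" using large by auto
  then have d: "d > 0" "d\<^sup>2 = 2 * (1 - cos (\<theta> - \<phi>))" "d = sqrt (2 * (1 - cos (\<phi> - \<theta>)))"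
    using cos_le_one[of "\<theta> - \<phi>"] cos_minus[of "\<theta> - \<phi>"] by (auto simp: d_def less_le)
  \<comment> \<open>This weight makes the gain of an x-letter exactly 2 (\<open>sx\<close>). The
    gain of a y-letter is then at least 2 (\<open>sy\<close>) because |x y| d^2 \<ge> 4, which is
    the hypothesis. A gain of 2 is what lets dominance change sides: 2 p - q \<ge> p whenever q
    \<le> p.\<close>
  define s where "s = 2 / (\<bar>x\<bar> * d)"
  have s: "s > 0" using xy d(1) by (simp add: s_def)
  define p where "p u = cmod (fix_form \<theta> u)" for u
  define q where "q u = s * cmod (fix_form \<phi> u)" for u
  have pos: "p u \<ge> 0" "q u \<ge> 0" for u using s by (simp_all add: p_def q_def)
  have sx: "s * (\<bar>x\<bar> * d) = 2" using xy d(1) by (simp add: s_def)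
  have sy: "\<bar>y\<bar> * d \<ge> 2 * s"
  proof -
    have "\<bar>y\<bar> * d * (\<bar>x\<bar> * d) = \<bar>x * y\<bar> * d\<^sup>2" by (simp add: power2_eq_square abs_mult)
    also have "\<dots> = 2 * (\<bar>x * y\<bar> * (1 - cos (\<theta> - \<phi>)))" unfolding d(2) by (rule mult.left_commute)
    also have "\<dots> \<ge> 4" using large by simp
    finally have "4 / (\<bar>x\<bar> * d) \<le> \<bar>y\<bar> * d" using xy d(1) by (simp add: pos_divide_le_eq)
    then show ?thesis by (simp add: s_def)
  qed
  have step_True: "p (letter x \<theta> y \<phi> True m *v u) = p u" "q (letter x \<theta> y \<phi> True m *v u) \<ge> 2 * p u - q u"
    if m: "m \<noteq> 0" for m u
  proof -
    show "p (letter x \<theta> y \<phi> True m *v u) = p u" by (simp add: p_def letter_def fix_form_par_mat_same)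
    have "1 \<le> \<bar>real_of_int m\<bar>" using m by linarith
    then have "2 * p u \<le> \<bar>real_of_int m\<bar> * (s * (\<bar>x\<bar> * d)) * p u"
      unfolding sx using pos(1)[of u] by (intro mult_right_mono) auto
    also have "\<dots> - q u \<le> q (letter x \<theta> y \<phi> True m *v u)"
    proof -
      have "s * (\<bar>of_int m * x\<bar> * d * p u - cmod (fix_form \<phi> u)) \<le> q (letter x \<theta> y \<phi> True m *v u)"
        unfolding q_def p_def letter_def d_def using s cmod_fix_form_par_mat[of "of_int m * x" \<theta> \<phi> u]
        by (intro mult_left_mono) auto
      then show ?thesis by (simp add: q_def abs_mult algebra_simps)
    qed
    finally show "q (letter x \<theta> y \<phi> True m *v u) \<ge> 2 * p u - q u" by simp
  qed
  have step_False: "q (letter x \<theta> y \<phi> False m *v u) = q u" "p (letter x \<theta> y \<phi> False m *v u) \<ge> 2 * q u - p u"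
    if m: "m \<noteq> 0" for m u
  proof -
    show "q (letter x \<theta> y \<phi> False m *v u) = q u" by (simp add: q_def letter_def fix_form_par_mat_same)
    have "1 \<le> \<bar>real_of_int m\<bar>" using m by linarith
    then have "1 * (2 * s) \<le> \<bar>real_of_int m\<bar> * (\<bar>y\<bar> * d)"
      using sy s by (intro mult_mono[of 1 _ "2 * s"]) auto
    then have "1 * (2 * s) * cmod (fix_form \<phi> u) \<le> \<bar>real_of_int m\<bar> * (\<bar>y\<bar> * d) * cmod (fix_form \<phi> u)"
      by (rule mult_right_mono) simp
    moreover have "\<bar>of_int m * y\<bar> * d * cmod (fix_form \<phi> u) - p u \<le> p (letter x \<theta> y \<phi> False m *v u)"
      using cmod_fix_form_par_mat[of "of_int m * y" \<phi> \<theta> u] by (simp add: p_def letter_def d(3))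
    ultimately show "p (letter x \<theta> y \<phi> False m *v u) \<ge> 2 * q u - p u"
      by (simp add: q_def abs_mult mult.assoc)
  qed
  \<comment> \<open>Two starting vectors are needed because the first letter applied fixes one of
    them.\<close>
  define u v where "u = fix_vec \<theta>" and "v = fix_vec \<phi>"
  have u: "p u = 0" "q u = s * d" and v: "p v = d" "q v = 0"
    using d(3) by (simp_all add: u_def v_def p_def q_def cmod_fix_form_fix_vec d_def)
  \<comment> \<open>The disjunct is decided by the letter applied first: an x-letter moves v, a
    y-letter moves u. The induction keeps the same disjunct throughout.\<close>
  have pingpong: "(b \<longrightarrow> p (A *v u) \<le> q (A *v u) \<and> 2 * (s * d) \<le> q (A *v u) \<or>
                        p (A *v v) \<le> q (A *v v) \<and> 2 * d \<le> q (A *v v)) \<and>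
                  (\<not> b \<longrightarrow> q (A *v u) \<le> p (A *v u) \<and> 2 * (s * d) \<le> p (A *v u) \<or>
                        q (A *v v) \<le> p (A *v v) \<and> 2 * d \<le> p (A *v v))"
    if "reduced_word x \<theta> y \<phi> b A" for b A
    using that
  proof induction
    case (single m b)
    show ?case
      using step_True[OF single, of v] step_False[OF single, of u] u v d(1) mult_pos_pos[OF s d(1)]
      by (cases b) auto
  next
    case (step m b A)
    have "letter x \<theta> y \<phi> b m ** A *v z = letter x \<theta> y \<phi> b m *v (A *v z)" for z
      by (simp add: matrix_vector_mul_assoc)
    then show ?case
      using step_True[OF step(1), of "A *v u"] step_True[OF step(1), of "A *v v"]
        step_False[OF step(1), of "A *v u"] step_False[OF step(1), of "A *v v"] step(3)
      by (cases b) auto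
  qed
  \<comment> \<open>An open neighbourhood of the identity: all four values there are at most half
    the bounds, whereas every reduced word reaches one of the bounds.\<close>
  define Q where "Q A \<longleftrightarrow> p (A *v u) < 2 * (s * d) \<and> q (A *v u) < 2 * (s * d) \<and>
      p (A *v v) < 2 * d \<and> q (A *v v) < 2 * d" for A
  have notQ: "\<not> Q A" if "reduced_word x \<theta> y \<phi> b A" for b A
    using pingpong[OF that] by (cases b) (auto simp: Q_def)
  have "(- A :: complex ^ 2 ^ 2) *v z = - (A *v z)" for A z
    by (simp add: vec_eq_iff matrix_vector_mult_def sum_negf)
  then have Qm: "Q (- A) = Q A" for A
    by (simp add: Q_def p_def q_def fix_form_minus)
  have "open {A. Q A}"
    unfolding Q_def p_def q_def fix_form_def matrix_vector_mult_def
    by (intro open_Collect_conj open_Collect_less continuous_intros)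
  moreover have "Q (mat 1)" using u v d(1) s by (simp add: Q_def)
  ultimately obtain e where e: "e > 0" "ball (mat 1) e \<subseteq> {A. Q A}"
    by (metis mem_Collect_eq open_contains_ball)
  obtain n where n: "1 / real (Suc n) < e" using nat_approx_posE[OF e(1)] by blast
  have "far_from_one (1 / real (Suc n)) (word_mat x \<theta> y \<phi> w)" for w
  proof (cases "word_mat x \<theta> y \<phi> w = mat 1")
    case False
    then obtain b where "reduced_word x \<theta> y \<phi> b (word_mat x \<theta> y \<phi> w)" using word_mat_reduced by blast
    then have "\<not> Q (word_mat x \<theta> y \<phi> w)" "\<not> Q (- word_mat x \<theta> y \<phi> w)"
      using notQ Qm by auto
    then have "e \<le> dist (word_mat x \<theta> y \<phi> w) (mat 1)" "e \<le> dist (- word_mat x \<theta> y \<phi> w) (mat 1)"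
      using e(2) by (force simp: subset_eq dist_commute not_le[symmetric])+
    then show ?thesis using n by (auto simp: far_from_one_def)
  qed (simp add: far_from_one_def)
  then show ?thesis unfolding discrete_iff_words by blast
qed

section \<open>Powers of an elliptic product\<close>

lemma cayley_hamilton_trace:
  fixes A :: "complex ^ 2 ^ 2"
  assumes "det A = 1" "A $ 1 $ 1 + A $ 2 $ 2 = of_real t"
  shows "A ** A = t *\<^sub>R A - mat 1"
proof -
  have d: "A $ 1 $ 1 * A $ 2 $ 2 - A $ 1 $ 2 * A $ 2 $ 1 = 1" using assms(1) by (simp add: det_2)
  have t: "complex_of_real t = A $ 1 $ 1 + A $ 2 $ 2" using assms(2) by simp
  show ?thesis
    unfolding matrix2_eq_iff matrix2_mult_nth vector_minus_component vector_scaleR_component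
      scaleR_conv_of_real[where 'a = complex] t mat1_nth
    using d by (intro conjI) (simp_all add: algebra_simps)
qed

lemma matrix_mult_scaleR_right: "A ** (c *\<^sub>R B) = c *\<^sub>R (A ** B)"
  for A B :: "complex ^ 2 ^ 2"
  by (simp add: matrix2_eq_iff matrix2_mult_nth scaleR_right_distrib)

lemma matrix_mult_diff_right: "A ** (B - C) = A ** B - A ** C"
  for A B C :: "complex ^ 2 ^ 2"
  by (simp add: matrix2_eq_iff matrix2_mult_nth algebra_simps)

text \<open>The coefficients are Chebyshev polynomials of the second kind at cos t, generated by the
  recursion A^2 = 2 (cos t) A - 1. Writing n t - t inside the sine lets the formula cover n =
  0.\<close>

lemma word_mat_replicate:
  assumes tr: "word_mat x \<theta> y \<phi> w $ 1 $ 1 + word_mat x \<theta> y \<phi> w $ 2 $ 2 = of_real (2 * cos t)"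
    and t: "sin t \<noteq> 0"
  shows "word_mat x \<theta> y \<phi> (concat (replicate n w)) =
    (sin (real n * t) / sin t) *\<^sub>R word_mat x \<theta> y \<phi> w - (sin (real n * t - t) / sin t) *\<^sub>R mat 1"
proof (induction n)
  case 0
  then show ?case using t by simp
next
  case (Suc n)
  let ?A = "word_mat x \<theta> y \<phi> w"
  let ?s = "sin (real n * t) / sin t" and ?r = "sin (real n * t - t) / sin t"
  have "word_mat x \<theta> y \<phi> (concat (replicate (Suc n) w)) = ?A ** (?s *\<^sub>R ?A - ?r *\<^sub>R mat 1)"
    by (simp add: word_mat_append Suc)
  also have "\<dots> = ?s *\<^sub>R (?A ** ?A) - ?r *\<^sub>R ?A"
    by (simp add: matrix_mult_diff_right matrix_mult_scaleR_right)
  also have "\<dots> = (?s * (2 * cos t) - ?r) *\<^sub>R ?A - ?s *\<^sub>R mat 1"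
    unfolding cayley_hamilton_trace[OF det_word_mat tr] by (simp add: scaleR_diff_right scaleR_diff_left)
  also have "?s * (2 * cos t) - ?r = sin (real (Suc n) * t) / sin t"
    by (simp add: distrib_right sin_add sin_diff add_divide_distrib diff_divide_distrib)
  finally show ?case by (simp add: distrib_right)
qed

lemma sin_eq_0_imp_rat_multiple_pi:
  assumes "sin (real n * t) = 0" "n > 0"
  shows "\<exists>r\<in>\<rat>. t = pi * r"
proof -
  obtain i :: int where "real n * t = of_int i * pi" using assms(1) sin_zero_iff_int2 by auto
  then have "t = pi * (of_int i / of_nat n)" using assms(2) by (simp add: field_simps)
  then show ?thesis by (intro bexI[of _ "of_int i / of_nat n"]) auto
qed

text \<open>Dirichlet approximation of t / (2 pi) with N > 2 pi / d.\<close>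

lemma multiples_near_0_mod_2pi:
  fixes t d :: real
  assumes "d > 0"
  obtains n k where "n > 0" "\<bar>real n * t - 2 * pi * of_int k\<bar> < d"
proof -
  obtain N where N: "N > 0" "2 * pi / d < real N"
    using reals_Archimedean2[of "2 * pi / d"] assms pi_gt_zero
    by (metis divide_pos_pos gr0I less_asym mult_pos_pos of_nat_0 zero_less_numeral)
  obtain q p :: int where q: "0 < q" "\<bar>of_int q * (t / (2 * pi)) - of_int p\<bar> < 1 / N"
    using Dirichlet_approx[OF N(1), of "t / (2 * pi)"] by metis
  have "real (nat q) * t - 2 * pi * of_int p = 2 * pi * (of_int q * (t / (2 * pi)) - of_int p)"
    using q(1) by (simp add: right_diff_distrib)
  then have "\<bar>real (nat q) * t - 2 * pi * of_int p\<bar> = 2 * pi * \<bar>of_int q * (t / (2 * pi)) - of_int p\<bar>"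
    by (simp add: abs_mult)
  also have "\<dots> < 2 * pi * (1 / N)" using q(2) by (intro mult_strict_left_mono) auto
  also have "\<dots> < d" using N assms by (simp add: pos_divide_less_eq mult.commute)
  finally show thesis using that[of "nat q" p] q(1) by simp
qed

lemma not_discrete_if_small:
  assumes small: "0 < \<bar>x * y\<bar> * (1 - cos (\<theta> - \<phi>))" "\<bar>x * y\<bar> * (1 - cos (\<theta> - \<phi>)) < 2"
    and irr: "\<And>r. r \<in> \<rat> \<Longrightarrow> \<bar>x * y\<bar> * (1 - cos (\<theta> - \<phi>)) \<noteq> 1 - cos (pi * r)"
  shows "\<not> discrete_in_PSL2C (generate disc_group {parabolic_elt x \<theta>, parabolic_elt y \<phi>})"
proof
  assume "discrete_in_PSL2C (generate disc_group {parabolic_elt x \<theta>, parabolic_elt y \<phi>})"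
  then obtain N where N: "\<And>w. far_from_one (1 / real (Suc N)) (word_mat x \<theta> y \<phi> w)"
    unfolding discrete_iff_words by blast
  define k where "k = \<bar>x * y\<bar> * (1 - cos (\<theta> - \<phi>))"
  define t where "t = arccos (1 - k)"
  have k: "0 < k" "k < 2" using small by (simp_all add: k_def)
  have t: "0 < t" "t < pi" "cos t = 1 - k"
    using k arccos_lt_bounded[of "1 - k"] by (simp_all add: t_def)
  have sint: "sin t > 0" using t by (intro sin_gt_zero)
  have irrt: "\<not> (\<exists>r\<in>\<rat>. t = pi * r)" 
  proof
    assume "\<exists>r\<in>\<rat>. t = pi * r"
    then obtain r where "r \<in> \<rat>" "t = pi * r" by blast
    then show False using irr[of r] t(3) unfolding k_def by simp
  qed
  \<comment> \<open>The sign selects whichever of f g and f g^-1 has trace 2 - 2 \<kappa>; the other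
    one has trace 2 + 2 \<kappa> and is hyperbolic.\<close>
  define m :: int where "m = (if x * y > 0 then 1 else - 1)"
  define w where "w = [(True, 1), (False, m)]"
  define A where "A = word_mat x \<theta> y \<phi> w"
  have detA: "det A = 1" by (simp add: A_def det_word_mat)
  have "A = par_mat x \<theta> ** par_mat (of_int m * y) \<phi>"
    by (simp add: A_def w_def letter_def)
  then have "A $ 1 $ 1 + A $ 2 $ 2 = 2 - 2 * of_real (of_int m * (x * y)) + of_real (of_int m * (x * y)) * (cis (\<theta> - \<phi>) + cis (\<phi> - \<theta>))"
    by (simp add: matrix2_mult_nth par_mat_def complex_eq_iff cos_diff sin_diff algebra_simps)
  also have "of_int m * (x * y) = \<bar>x * y\<bar>" by (auto simp: m_def)
  also have "cis (\<theta> - \<phi>) + cis (\<phi> - \<theta>) = of_real (2 * cos (\<theta> - \<phi>))"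
    using cos_minus[of "\<theta> - \<phi>"] sin_minus[of "\<theta> - \<phi>"] by (simp add: complex_eq_iff)
  finally have trA: "A $ 1 $ 1 + A $ 2 $ 2 = of_real (2 * cos t)"
    unfolding t(3) k_def by (simp add: algebra_simps)
  \<comment> \<open>The formula for powers, extended to real arguments. It is continuous at 0 and
    has period 2 pi, so powers with n t near 0 modulo 2 pi are close to the identity.\<close>
  define h where "h s = (sin s / sin t) *\<^sub>R A - (sin (s - t) / sin t) *\<^sub>R (mat 1 :: complex ^ 2 ^ 2)" for s
  have power: "word_mat x \<theta> y \<phi> (concat (replicate n w)) = h (real n * t)" for n
    using word_mat_replicate[OF trA[unfolded A_def]] sint by (simp add: h_def A_def)
  have "isCont h 0" unfolding h_def using sint by (intro continuous_intros) auto
  moreover have "h 0 = mat 1" using sint by (simp add: h_def)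
  moreover have "1 / real (Suc N) > 0" by simp
  ultimately have "\<exists>d>0. \<forall>s. dist s 0 < d \<longrightarrow> dist (h s) (mat 1) < 1 / real (Suc N)"
    unfolding continuous_at_eps_delta by metis
  then obtain d where d: "d > 0" "\<And>s. \<bar>s\<bar> < d \<Longrightarrow> dist (h s) (mat 1) < 1 / real (Suc N)"
    by (auto simp: dist_real_def)
  obtain n j where n: "n > 0" "\<bar>real n * t - 2 * pi * of_int j\<bar> < d"
    using multiples_near_0_mod_2pi[OF d(1)] by blast
  have "h (real n * t) = h (real n * t - 2 * pi * of_int j)"
    by (simp add: h_def sin_diff cos_diff)
  then have "dist (h (real n * t)) (mat 1) < 1 / real (Suc N)" using d(2)[OF n(2)] by simp
  moreover have "far_from_one (1 / real (Suc N)) (h (real n * t))"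
    using N[of "concat (replicate n w)"] unfolding power .
  ultimately have pm: "h (real n * t) = mat 1 \<or> h (real n * t) = - mat 1"
    by (auto simp: far_from_one_def)
  \<comment> \<open>A power so close to the identity must be plus or minus the identity. As its
    coefficient of A is nonzero, A itself would be scalar, which contradicts sin t > 0.\<close>
  have sn: "sin (real n * t) \<noteq> 0" using sin_eq_0_imp_rat_multiple_pi[OF _ n(1)] irrt by blast
  have off: "A $ 1 $ 2 = 0" "A $ 2 $ 1 = 0"
    using pm sn sint unfolding matrix2_eq_iff h_def by auto
  have "h (real n * t) $ 1 $ 1 = h (real n * t) $ 2 $ 2" using pm by auto
  then have "A $ 1 $ 1 = A $ 2 $ 2" using sn sint by (simp add: h_def)
  with off have "A $ 1 $ 1 * A $ 1 $ 1 = 1" "2 * A $ 1 $ 1 = of_real (2 * cos t)"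
    using detA trA by (simp_all add: det_2)
  then have "of_real (cos t) * of_real (cos t) = (1 :: complex)" by simp
  then have "cos t * cos t = 1" by (metis of_real_eq_1_iff of_real_mult)
  then have "sin t = 0" using sin_cos_squared_add[of t] by (simp add: power2_eq_square)
  then show False using sint by simp
qed

section \<open>The probability\<close>

text \<open>For \<open>par_mat x \<theta>\<close> the corner entry is 1 + \<i> x, whose square has
  imaginary part 2 x, and the product of the first-row entries is (1 + \<i> x) x cis \<theta>. The
  divisor has real part 1, so the map is continuous on all matrices. Reading off x cis \<theta>
  instead of \<theta> avoids the choice of an argument.\<close>

definition coord_mat :: "complex ^ 2 ^ 2 \<Rightarrow> real \<times> complex" where
  "coord_mat A = (Im ((A $ 1 $ 1)\<^sup>2) / 2,
     A $ 1 $ 1 * A $ 1 $ 2 / (1 + \<i> * of_real (Im ((A $ 1 $ 1)\<^sup>2) / 2)))"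

text \<open>\<open>coord\<close> reads off \<open>(x, x * cis \<theta>)\<close> from a parabolic element; it uses only
  sign-invariant expressions in the matrix entries.\<close>

definition coord :: "(complex ^ 2 ^ 2) set \<Rightarrow> real \<times> complex" where
  "coord X = coord_mat (SOME A. A \<in> X)"

lemma coord_mat_uminus: "coord_mat (- A) = coord_mat A"
  by (simp add: coord_mat_def)

lemma coord_pm_class: "coord (pm_class A) = coord_mat A"
proof -
  have "(SOME B. B \<in> pm_class A) \<in> pm_class A" by (rule someI[of _ A]) (simp add: pm_class_eq)
  then show ?thesis by (auto simp: coord_def pm_class_eq coord_mat_uminus)
qed

lemma coord_parabolic_elt: "coord (parabolic_elt x \<theta>) = (x, of_real x * cis \<theta>)"
proof -
  have "Im ((1 + \<i> * of_real x)\<^sup>2) / 2 = x" by (simp add: power2_eq_square)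
  moreover have "1 + \<i> * complex_of_real x \<noteq> 0" by (simp add: complex_eq_iff)
  ultimately show ?thesis
    by (simp add: parabolic_elt_eq coord_pm_class coord_mat_def par_mat_def)
qed

lemma continuous_on_coord_mat: "continuous_on UNIV coord_mat"
proof -
  have nz: "1 + \<i> * complex_of_real r \<noteq> 0" for r by (simp add: complex_eq_iff)
  show ?thesis unfolding coord_mat_def[abs_def]
    by (intro continuous_intros ballI nz) auto
qed

text \<open>This is what allows independence with respect to \<open>PSL2C_borel\<close> to be
  transferred to real and complex coordinates.\<close>

lemma measurable_coord: "coord \<in> borel_measurable PSL2C_borel"
proof (rule borel_measurableI)
  fix S :: "(real \<times> complex) set" assume "open S"
  then have "open (coord_mat -` S)" using continuous_on_coord_mat by (rule open_vimage)
  then have "openin PSL2C_topology (pm_class ` {A \<in> carrier SL2C. coord_mat A \<in> S})"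
    by (intro openin_pm_class_image) (auto simp: coord_mat_uminus vimage_def)
  moreover have "coord -` S \<inter> space PSL2C_borel = pm_class ` {A \<in> carrier SL2C. coord_mat A \<in> S}"
    by (auto simp: PSL2C_borel_def space_measure_of_conv carrier_PSL2C coord_pm_class)
  moreover have "{U. openin PSL2C_topology U} \<subseteq> Pow (carrier PSL2C)"
    by (auto simp: openin_PSL2C_topology)
  ultimately show "coord -` S \<inter> space PSL2C_borel \<in> sets PSL2C_borel"
    unfolding PSL2C_borel_def by (auto intro!: in_measure_of)
qed

lemma continuous_on_par_mat:
  assumes "continuous_on S f" "continuous_on S g"
  shows "continuous_on S (\<lambda>p. par_mat (f p) (g p))"
proof -
  have "continuous_on S (\<lambda>p. par_mat (f p) (g p) $ i $ j)" for i j
  proof -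
    have "par_mat (f p) (g p) $ i $ j =
        (if i = 1 then if j = 1 then 1 + \<i> * of_real (f p) else of_real (f p) * cis (g p)
         else if j = 1 then of_real (f p) * cis (- g p) else 1 - \<i> * of_real (f p))" for p
      using exhaust_2[of i] exhaust_2[of j] by (auto simp: par_mat_def)
    then show ?thesis
      by (cases "i = 1"; cases "j = 1") (simp_all, (intro continuous_intros assms)+)
  qed
  then have "continuous_on S (\<lambda>p. \<chi> i j. par_mat (f p) (g p) $ i $ j)"
    by (intro continuous_on_vec_lambda)
  then show ?thesis by simp
qed

lemma continuous_on_word_mat:
  assumes [continuous_intros]: "continuous_on S x" "continuous_on S \<theta>" "continuous_on S y" "continuous_on S \<phi>"
  shows "continuous_on S (\<lambda>p. word_mat (x p) (\<theta> p) (y p) (\<phi> p) w)"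
proof (induction w)
  case (Cons l w)
  have "continuous_on S (\<lambda>p. letter (x p) (\<theta> p) (y p) (\<phi> p) (fst l) (snd l))"
    unfolding letter_def by (cases "fst l") (simp_all add: continuous_on_par_mat continuous_intros)
  with Cons show ?case by (simp add: continuous_on_matrix_mult)
qed simp

lemma measurable_word_mat:
  assumes [measurable]: "x \<in> borel_measurable M" "\<theta> \<in> borel_measurable M"
    "y \<in> borel_measurable M" "\<phi> \<in> borel_measurable M"
  shows "(\<lambda>\<omega>. word_mat (x \<omega>) (\<theta> \<omega>) (y \<omega>) (\<phi> \<omega>) w) \<in> borel_measurable M"
proof -
  define F where "F p = word_mat (fst p) (fst (snd p)) (fst (snd (snd p))) (snd (snd (snd p))) w" for p
  have "F \<in> borel_measurable borel" unfolding F_def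
    by (intro borel_measurable_continuous_onI continuous_on_word_mat continuous_intros)
  then have "(\<lambda>\<omega>. F (x \<omega>, \<theta> \<omega>, y \<omega>, \<phi> \<omega>)) \<in> borel_measurable M"
    by (rule measurable_compose[rotated]) measurable
  then show ?thesis by (simp add: F_def)
qed

text \<open>By \<open>discrete_iff_words\<close> the event is a countable union of countable
  intersections of closed conditions on words, which depend continuously on the parameters.\<close>

lemma measurable_discrete:
  assumes [measurable]: "x \<in> borel_measurable M" "\<theta> \<in> borel_measurable M"
    "y \<in> borel_measurable M" "\<phi> \<in> borel_measurable M"
  shows "{\<omega> \<in> space M. discrete_in_PSL2C
     (generate disc_group {parabolic_elt (x \<omega>) (\<theta> \<omega>), parabolic_elt (y \<omega>) (\<phi> \<omega>)})} \<in> sets M"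
proof -
  note measurable_word_mat[measurable]
  have "closed {A. far_from_one e A}" for e
    unfolding far_from_one_def
    by (intro closed_Collect_disj closed_Collect_conj closed_Collect_eq closed_Collect_le continuous_intros)
  then have [measurable]: "Measurable.pred borel (far_from_one e)" for e
    by (simp add: pred_def borel_closed)
  show ?thesis unfolding discrete_iff_words by measurable
qed

section \<open>Uniform laws and the iterated integral\<close>

definition unif :: "real \<Rightarrow> real measure" where
  "unif b = uniform_measure lborel {0..b}"

lemma sets_unif [simp, measurable_cong]: "sets (unif b) = sets borel"
  by (simp add: unif_def)

lemma space_unif [simp]: "space (unif b) = UNIV"
  by (simp add: unif_def)

lemma prob_space_unif: "b > 0 \<Longrightarrow> prob_space (unif b)"
  unfolding unif_def by (rule prob_space_uniform_measure) auto

lemma sigma_finite_unif: "b > 0 \<Longrightarrow> sigma_finite_measure (unif b)"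
  using prob_space_unif by (simp add: prob_space_imp_sigma_finite)

lemma AE_unif:
  assumes "countable N" "\<And>x. x \<in> {0..b} \<Longrightarrow> x \<notin> N \<Longrightarrow> P x"
  shows "AE x in unif b. P x"
  unfolding unif_def
proof (rule AE_uniform_measureI)
  have "AE x in lborel. x \<notin> N" by (rule AE_not_in[OF countable_imp_null_set_lborel[OF assms(1)]])
  then show "AE x in lborel. x \<in> {0..b} \<longrightarrow> P x" by eventually_elim (use assms(2) in blast)
qed simp

lemma nn_integral_unif:
  assumes "b > 0" and [measurable]: "f \<in> borel_measurable borel"
    and nn: "\<And>x. x \<in> {0..b} \<Longrightarrow> 0 \<le> f x" and I: "(f has_integral I) {0..b}"
  shows "(\<integral>\<^sup>+x. ennreal (f x) \<partial>unif b) = ennreal (I / b)"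
proof -
  have "(\<integral>\<^sup>+x. ennreal (f x) \<partial>unif b) = (\<integral>\<^sup>+x. ennreal (f x) * indicator {0..b} x \<partial>lborel) / emeasure lborel {0..b}"
    unfolding unif_def by (rule nn_integral_uniform_measure) simp_all
  also have "(\<integral>\<^sup>+x. ennreal (f x) * indicator {0..b} x \<partial>lborel) = ennreal I"
    by (rule nn_integral_has_integral_lebesgue'[OF nn I])
  also have "\<dots> / emeasure lborel {0..b} = ennreal (I / b)"
    using assms(1) has_integral_nonneg[OF I nn] by (simp add: divide_ennreal)
  finally show ?thesis .
qed

lemma distr_uniform_rv:
  assumes "uniform_rv M X 0 b" "b > 0"
  shows "X \<in> borel_measurable M" "distr M borel X = unif b"
proof -
  have d: "distributed M lborel X (\<lambda>x. ennreal (indicator {0..b} x / measure lborel {0..b}))"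
    using assms(1) by (simp add: uniform_rv_def)
  show "X \<in> borel_measurable M" using distributed_measurable[OF d] by simp
  have "distr M borel X = distr M lborel X" by (rule distr_cong) simp_all
  also have "\<dots> = density lborel (\<lambda>x. ennreal (indicator {0..b} x / measure lborel {0..b}))"
    by (rule distributed_distr_eq_density[OF d])
  also have "\<dots> = unif b"
    unfolding unif_def uniform_measure_def using assms(2)
    by (intro density_cong) (auto simp: divide_ennreal[symmetric] ennreal_indicator)
  finally show "distr M borel X = unif b" .
qed

lemma measurable_cot [measurable]: "(cot :: real \<Rightarrow> real) \<in> borel_measurable borel"
  unfolding cot_def[abs_def] by measurable

lemma measurable_coord_random:
  assumes "random_parabolic M f"
  shows "(\<lambda>\<omega>. coord (f \<omega>)) \<in> borel_measurable M"
proof -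
  obtain \<theta> \<eta> where u: "uniform_rv M \<theta> 0 (2 * pi)" "uniform_rv M \<eta> 0 pi"
    and f: "\<And>\<omega>. \<omega> \<in> space M \<Longrightarrow> f \<omega> = parabolic_elt (cot (\<eta> \<omega>)) (\<theta> \<omega>)"
    using assms by (auto simp: random_parabolic_def)
  have [measurable]: "\<theta> \<in> borel_measurable M" "\<eta> \<in> borel_measurable M"
    using distr_uniform_rv(1)[OF u(1)] distr_uniform_rv(1)[OF u(2)] by simp_all
  have "(\<lambda>\<omega>. (cot (\<eta> \<omega>), complex_of_real (cot (\<eta> \<omega>)) * cis (\<theta> \<omega>))) \<in> borel_measurable M"
    unfolding cis_conv_exp by measurable
  then show ?thesis
    by (rule measurable_cong[THEN iffD1, rotated]) (simp add: f coord_parabolic_elt)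
qed

lemma nn_integral_random_parabolic:
  assumes "prob_space M" "random_parabolic M f" and k[measurable]: "k \<in> borel_measurable borel"
  shows "(\<integral>\<^sup>+\<omega>. k (coord (f \<omega>)) \<partial>M) =
    (\<integral>\<^sup>+\<theta>. \<integral>\<^sup>+\<eta>. k (cot \<eta>, of_real (cot \<eta>) * cis \<theta>) \<partial>unif pi \<partial>unif (2 * pi))"
proof -
  interpret prob_space M by fact
  interpret U: sigma_finite_measure "unif pi" by (rule sigma_finite_unif) simp
  obtain \<theta> \<eta> where u: "uniform_rv M \<theta> 0 (2 * pi)" "uniform_rv M \<eta> 0 pi"
    and ind: "indep_var borel \<theta> borel \<eta>"
    and f: "\<And>\<omega>. \<omega> \<in> space M \<Longrightarrow> f \<omega> = parabolic_elt (cot (\<eta> \<omega>)) (\<theta> \<omega>)"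
    using assms(2) by (auto simp: random_parabolic_def)
  have [measurable]: "\<theta> \<in> borel_measurable M" "\<eta> \<in> borel_measurable M"
    using distr_uniform_rv(1)[OF u(1)] distr_uniform_rv(1)[OF u(2)] by simp_all
  define \<psi> where "\<psi> p = (cot (snd p), complex_of_real (cot (snd p)) * cis (fst p))" for p :: "real \<times> real"
  have [measurable]: "\<psi> \<in> borel_measurable (borel \<Otimes>\<^sub>M borel)"
    unfolding \<psi>_def cis_conv_exp by measurable
  have "(\<integral>\<^sup>+\<omega>. k (coord (f \<omega>)) \<partial>M) = (\<integral>\<^sup>+\<omega>. k (\<psi> (\<theta> \<omega>, \<eta> \<omega>)) \<partial>M)"
    by (rule nn_integral_cong) (simp add: f coord_parabolic_elt \<psi>_def)
  also have "\<dots> = (\<integral>\<^sup>+p. k (\<psi> p) \<partial>distr M (borel \<Otimes>\<^sub>M borel) (\<lambda>\<omega>. (\<theta> \<omega>, \<eta> \<omega>)))"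
    by (subst nn_integral_distr) simp_all
  also have "distr M (borel \<Otimes>\<^sub>M borel) (\<lambda>\<omega>. (\<theta> \<omega>, \<eta> \<omega>)) = unif (2 * pi) \<Otimes>\<^sub>M unif pi"
    using ind distr_uniform_rv(2)[OF u(1)] distr_uniform_rv(2)[OF u(2)] unfolding indep_var_distribution_eq by simp
  also have "(\<integral>\<^sup>+p. k (\<psi> p) \<partial>(unif (2 * pi) \<Otimes>\<^sub>M unif pi)) =
      (\<integral>\<^sup>+\<theta>. \<integral>\<^sup>+\<eta>. k (\<psi> (\<theta>, \<eta>)) \<partial>unif pi \<partial>unif (2 * pi))"
    by (rule U.nn_integral_fst[symmetric]) measurable
  finally show ?thesis by (simp add: \<psi>_def)
qed

text \<open>On a pair of parabolic elements this is \<open>\<bar>x * y\<bar> * (1 - cos (\<theta> - \<phi>))\<close>,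
  that is, half of \<open>\<bar>tr (f g) - 2\<bar>\<close>.\<close>

definition pair_invariant :: "real \<times> complex \<Rightarrow> real \<times> complex \<Rightarrow> real" where
  "pair_invariant a b = \<bar>fst a * fst b - Re (snd a * cnj (snd b))\<bar>"

lemma pair_invariant_parabolic:
  "pair_invariant (x, of_real x * cis \<theta>) (y, of_real y * cis \<phi>) = \<bar>x * y\<bar> * (1 - cos (\<theta> - \<phi>))"
proof -
  have "x * y - Re (of_real x * cis \<theta> * cnj (of_real y * cis \<phi>)) = x * y * (1 - cos (\<theta> - \<phi>))"
    by (simp add: cos_diff algebra_simps)
  then show ?thesis by (simp add: pair_invariant_def abs_mult)
qed

lemma measurable_pair_invariant [measurable]:
  "(\<lambda>p. pair_invariant (fst p) (snd p)) \<in> borel_measurable (borel \<Otimes>\<^sub>M borel)"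
  unfolding pair_invariant_def borel_prod
  by (intro borel_measurable_continuous_onI continuous_intros)

text \<open>Independence is used once between the two cosets, through \<open>coord\<close>, and once
  inside each element, between its angle and its cotangent parameter. Joint independence of all four
  parameters is never assumed; Fubini yields the fourfold integral.\<close>

lemma emeasure_pair_invariant:
  assumes M: "prob_space M" "random_parabolic M f" "random_parabolic M g"
    and ind: "prob_space.indep_var M PSL2C_borel f PSL2C_borel g"
    and S[measurable]: "S \<in> sets borel"
  shows "emeasure M {\<omega> \<in> space M. pair_invariant (coord (f \<omega>)) (coord (g \<omega>)) \<in> S} =
    (\<integral>\<^sup>+\<theta>. \<integral>\<^sup>+\<eta>. \<integral>\<^sup>+\<phi>. \<integral>\<^sup>+\<zeta>. indicator S (\<bar>cot \<eta> * cot \<zeta>\<bar> * (1 - cos (\<theta> - \<phi>)))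
       \<partial>unif pi \<partial>unif (2 * pi) \<partial>unif pi \<partial>unif (2 * pi))"
proof -
  interpret prob_space M by fact
  let ?F = "\<lambda>\<omega>. coord (f \<omega>)" and ?G = "\<lambda>\<omega>. coord (g \<omega>)"
  have [measurable]: "?F \<in> borel_measurable M" "?G \<in> borel_measurable M"
    using M measurable_coord_random by auto
  interpret G: prob_space "distr M borel ?G" by (rule prob_space_distr) simp
  have "indep_var borel (coord \<circ> f) borel (coord \<circ> g)"
    by (rule indep_var_compose[OF ind measurable_coord measurable_coord])
  then have dist: "distr M (borel \<Otimes>\<^sub>M borel) (\<lambda>\<omega>. (?F \<omega>, ?G \<omega>)) = distr M borel ?F \<Otimes>\<^sub>M distr M borel ?G"
    unfolding indep_var_distribution_eq comp_def by simp
  let ?I = "\<lambda>a b. indicator S (pair_invariant a b) :: ennreal"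
  have meas[measurable]: "(\<lambda>p. ?I (fst p) (snd p)) \<in> borel_measurable (borel \<Otimes>\<^sub>M borel)"
    by measurable
  have meas2: "(\<lambda>a. \<integral>\<^sup>+b. ?I a b \<partial>distr M borel ?G) \<in> borel_measurable borel"
  proof -
    have "(\<lambda>p. ?I (fst p) (snd p)) \<in> borel_measurable (borel \<Otimes>\<^sub>M distr M borel ?G)"
      using meas by (simp cong: measurable_cong_sets)
    from G.borel_measurable_nn_integral_fst[OF this] show ?thesis by simp
  qed
  have "emeasure M {\<omega> \<in> space M. pair_invariant (?F \<omega>) (?G \<omega>) \<in> S} = (\<integral>\<^sup>+\<omega>. ?I (?F \<omega>) (?G \<omega>) \<partial>M)"
  proof -
    have "(\<lambda>\<omega>. pair_invariant (?F \<omega>) (?G \<omega>)) \<in> borel_measurable M"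
      using measurable_compose[OF _ measurable_pair_invariant, of "\<lambda>\<omega>. (?F \<omega>, ?G \<omega>)" M] by simp
    then have "{\<omega> \<in> space M. pair_invariant (?F \<omega>) (?G \<omega>) \<in> S} \<in> sets M" by measurable
    from nn_integral_indicator[OF this, symmetric] show ?thesis
      by (simp only:) (rule nn_integral_cong, simp add: indicator_def)
  qed
  also have "\<dots> = (\<integral>\<^sup>+p. ?I (fst p) (snd p) \<partial>distr M (borel \<Otimes>\<^sub>M borel) (\<lambda>\<omega>. (?F \<omega>, ?G \<omega>)))"
    by (subst nn_integral_distr) simp_all
  also have "\<dots> = (\<integral>\<^sup>+a. \<integral>\<^sup>+b. ?I a b \<partial>distr M borel ?G \<partial>distr M borel ?F)"
    unfolding dist by (subst G.nn_integral_fst[symmetric]) (simp_all cong: measurable_cong_sets)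
  also have "\<dots> = (\<integral>\<^sup>+\<omega>. \<integral>\<^sup>+b. ?I (?F \<omega>) b \<partial>distr M borel ?G \<partial>M)"
    using meas2 by (subst nn_integral_distr) simp_all
  finally have 1: "emeasure M {\<omega> \<in> space M. pair_invariant (?F \<omega>) (?G \<omega>) \<in> S} =
      (\<integral>\<^sup>+\<omega>. \<integral>\<^sup>+b. ?I (?F \<omega>) b \<partial>distr M borel ?G \<partial>M)" .
  note 2 = nn_integral_random_parabolic[OF M(1,2) meas2]
  have 3: "(\<integral>\<^sup>+b. ?I a b \<partial>distr M borel ?G) =
      (\<integral>\<^sup>+\<phi>. \<integral>\<^sup>+\<zeta>. ?I a (cot \<zeta>, of_real (cot \<zeta>) * cis \<phi>) \<partial>unif pi \<partial>unif (2 * pi))" for a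
  proof -
    have m: "(\<lambda>b. ?I a b) \<in> borel_measurable borel"
      using measurable_compose[OF measurable_Pair1' meas, of a] by simp
    have "(\<integral>\<^sup>+b. ?I a b \<partial>distr M borel ?G) = (\<integral>\<^sup>+\<omega>. ?I a (?G \<omega>) \<partial>M)"
      using m by (intro nn_integral_distr) simp_all
    also note nn_integral_random_parabolic[OF M(1,3) m]
    finally show ?thesis .
  qed
  show ?thesis unfolding 1 2 unfolding 3 pair_invariant_parabolic ..
qed

lemma nn_integral_abs_cot_ge:
  assumes k: "k \<ge> 0"
  shows "(\<integral>\<^sup>+\<zeta>. indicator {2..} (k * \<bar>cot \<zeta>\<bar>) \<partial>unif pi) = ennreal (2 / pi * arctan (k / 2))"
proof -
  define a where "a = arctan (k / 2)"
  define f where "f \<zeta> = (indicator {2..} (k * \<bar>cot \<zeta>\<bar>) :: real)" for \<zeta>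
  have a: "0 \<le> a" "a < pi/2" using k arctan_ubound[of "k/2"] by (simp_all add: a_def)
  have f: "f \<zeta> = (if \<zeta> \<le> a \<or> pi - a \<le> \<zeta> then 1 else 0)" if "0 < \<zeta>" "\<zeta> < pi" for \<zeta>
    using mult_abs_cot_ge_2_iff[OF k that] by (simp add: f_def a_def indicator_def)
  have "(f has_integral a) {0..a}"
  \<comment> \<open>The point 0 is exempt because the default \<open>cot 0 = 0\<close> makes f
    vanish there.\<close>
  proof (rule has_integral_spike_finite[of "{0}"])
    show "((\<lambda>_. 1) has_integral a) {0..a}" using has_integral_const_real[of "1::real" 0 a] a by simp
  qed (use f a in auto)
  moreover have "(f has_integral 0) {a..pi - a}"
    by (rule has_integral_spike_finite[of "{0, a, pi - a, pi}" _ _ "\<lambda>_. 0"]) (use f a in auto)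
  moreover have "(f has_integral a) {pi - a..pi}"
  proof (rule has_integral_spike_finite[of "{pi}"])
    show "((\<lambda>_. 1) has_integral a) {pi - a..pi}" using has_integral_const_real[of "1::real" "pi - a" pi] a by simp
  qed (use f a in auto)
  ultimately have "(f has_integral a + 0 + a) {0..pi}"
    using a by (intro has_integral_combine[of 0 "pi - a" pi] has_integral_combine[of 0 a "pi - a"]) auto
  then have "(\<integral>\<^sup>+\<zeta>. ennreal (f \<zeta>) \<partial>unif pi) = ennreal ((a + 0 + a) / pi)"
    by (intro nn_integral_unif) (auto simp: f_def[abs_def])
  then show ?thesis by (simp add: f_def a_def ennreal_indicator)
qed

text \<open>After the integrals over \<zeta> and \<phi> the integrand is (2 / pi) * arcsin (z
  \<eta>), free of \<theta>, so the outermost average is that of a constant.\<close>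

lemma nn_integral_pair_large:
  "(\<integral>\<^sup>+\<theta>. \<integral>\<^sup>+\<eta>. \<integral>\<^sup>+\<phi>. \<integral>\<^sup>+\<zeta>. indicator {2..} (\<bar>cot \<eta> * cot \<zeta>\<bar> * (1 - cos (\<theta> - \<phi>)))
     \<partial>unif pi \<partial>unif (2 * pi) \<partial>unif pi \<partial>unif (2 * pi)) = ennreal (4 * (arsinh 1)\<^sup>2 / pi\<^sup>2)"
proof -
  define z where "z \<eta> = \<bar>cot \<eta>\<bar> / (1 + sqrt (1 + \<bar>cot \<eta>\<bar>\<^sup>2))" for \<eta> :: real
  have z: "0 \<le> z \<eta>" "z \<eta> < 1" for \<eta>
  proof -
    have "\<bar>cot \<eta>\<bar> < 1 + sqrt (1 + \<bar>cot \<eta>\<bar>\<^sup>2)"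
      using real_le_rsqrt[of "\<bar>cot \<eta>\<bar>" "1 + \<bar>cot \<eta>\<bar>\<^sup>2"] by simp
    moreover have "0 < 1 + sqrt (1 + \<bar>cot \<eta>\<bar>\<^sup>2)" by (simp add: add_pos_nonneg)
    ultimately show "z \<eta> < 1" "0 \<le> z \<eta>" unfolding z_def by (simp_all only: pos_divide_less_eq) simp_all
  qed
  have 1: "(\<integral>\<^sup>+\<zeta>. indicator {2..} (\<bar>cot \<eta> * cot \<zeta>\<bar> * (1 - cos (\<theta> - \<phi>))) \<partial>unif pi) =
      ennreal (2 / pi * arctan (\<bar>cot \<eta>\<bar> * (1 - cos (\<theta> - \<phi>)) / 2))" for \<eta> \<theta> \<phi>
    using nn_integral_abs_cot_ge[of "\<bar>cot \<eta>\<bar> * (1 - cos (\<theta> - \<phi>))"]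
    by (simp add: abs_mult mult_ac)
  have 2: "(\<integral>\<^sup>+\<phi>. ennreal (2 / pi * arctan (\<bar>cot \<eta>\<bar> * (1 - cos (\<theta> - \<phi>)) / 2)) \<partial>unif (2 * pi)) =
      ennreal (2 / pi * arcsin (z \<eta>))" for \<eta> \<theta>
  proof -
    have "((\<lambda>\<phi>. 2 / pi * arctan (\<bar>cot \<eta>\<bar> * (1 - cos (\<theta> - \<phi>)) / 2)) has_integral
            2 / pi * (2 * pi * arcsin (z \<eta>))) {0..2 * pi}"
      unfolding z_def by (intro has_integral_mult_right integral_arctan_period) simp
    then have "(\<integral>\<^sup>+\<phi>. ennreal (2 / pi * arctan (\<bar>cot \<eta>\<bar> * (1 - cos (\<theta> - \<phi>)) / 2)) \<partial>unif (2 * pi)) =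
        ennreal (2 / pi * (2 * pi * arcsin (z \<eta>)) / (2 * pi))"
      by (rule nn_integral_unif[rotated 3]) auto
    then show ?thesis by simp
  qed
  have 3: "(\<integral>\<^sup>+\<eta>. ennreal (2 / pi * arcsin (z \<eta>)) \<partial>unif pi) = ennreal (4 * (arsinh 1)\<^sup>2 / pi\<^sup>2)"
  proof -
    \<comment> \<open>As z \<eta> < 1, the \<open>arctan\<close> form is available, and
      measurability in \<eta> is immediate from it.\<close>
    have "arcsin (z \<eta>) = arctan (z \<eta> / sqrt (1 - (z \<eta>)\<^sup>2))" for \<eta>
      using z[of \<eta>] by (intro arcsin_arctan) auto
    then have "(\<lambda>\<eta>. 2 / pi * arcsin (z \<eta>)) \<in> borel_measurable borel"
      unfolding z_def by simp
    moreover have "0 \<le> arcsin (z \<eta>)" for \<eta>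
      using z[of \<eta>] arcsin_le_arcsin[of 0 "z \<eta>"] by simp
    moreover have "((\<lambda>\<eta>. 2 / pi * arcsin (z \<eta>)) has_integral 2 / pi * (2 * (arsinh 1)\<^sup>2)) {0..pi}"
      unfolding z_def by (intro has_integral_mult_right integral_arcsin_cot)
    ultimately have "(\<integral>\<^sup>+\<eta>. ennreal (2 / pi * arcsin (z \<eta>)) \<partial>unif pi) =
        ennreal (2 / pi * (2 * (arsinh 1)\<^sup>2) / pi)"
      by (intro nn_integral_unif) auto
    then show ?thesis by (simp add: power2_eq_square)
  qed
  have "emeasure (unif (2 * pi)) (space (unif (2 * pi))) = 1"
    by (rule prob_space.emeasure_space_1[OF prob_space_unif]) simp
  then show ?thesis unfolding 1 2 3 by simp
qed

text \<open>Fixing the other three parameters, each value in S is attained by at most two \<zeta> in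
  (0, pi), provided cot \<eta> and 1 - cos (\<theta> - \<phi>) are nonzero; the exceptional \<phi>
  and \<eta> are countable as well.\<close>

lemma nn_integral_pair_countable:
  assumes S: "countable S"
  shows "(\<integral>\<^sup>+\<theta>. \<integral>\<^sup>+\<eta>. \<integral>\<^sup>+\<phi>. \<integral>\<^sup>+\<zeta>. indicator S (\<bar>cot \<eta> * cot \<zeta>\<bar> * (1 - cos (\<theta> - \<phi>)))
     \<partial>unif pi \<partial>unif (2 * pi) \<partial>unif pi \<partial>unif (2 * pi)) = 0"
proof -
  have \<zeta>: "(\<integral>\<^sup>+\<zeta>. indicator S (\<bar>cot \<eta> * cot \<zeta>\<bar> * (1 - cos (\<theta> - \<phi>))) \<partial>unif pi) = 0"
    if nz: "cot \<eta> \<noteq> 0" "cos (\<theta> - \<phi>) \<noteq> 1" for \<eta> \<theta> \<phi> :: real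
  proof -
    define k where "k = \<bar>cot \<eta>\<bar> * (1 - cos (\<theta> - \<phi>))"
    have k: "k \<noteq> 0" using nz by (simp add: k_def)
    \<comment> \<open>The solutions of s = k |cot \<zeta>| in (0, pi), since there arctan (cot
      \<zeta>) = pi/2 - \<zeta>; the endpoints, where this fails, are added.\<close>
    define N where "N = {0, pi} \<union> (\<lambda>s. pi/2 - arctan (s / k)) ` S \<union> (\<lambda>s. pi/2 + arctan (s / k)) ` S"
    have "AE \<zeta> in unif pi. \<bar>cot \<eta> * cot \<zeta>\<bar> * (1 - cos (\<theta> - \<phi>)) \<notin> S"
    proof (rule AE_unif)
      show "countable N" using S by (simp add: N_def)
      fix \<zeta> assume \<zeta>: "\<zeta> \<in> {0..pi}" "\<zeta> \<notin> N"
      then have b: "0 < \<zeta>" "\<zeta> < pi" by (auto simp: N_def)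
      show "\<bar>cot \<eta> * cot \<zeta>\<bar> * (1 - cos (\<theta> - \<phi>)) \<notin> S"
      proof
        assume "\<bar>cot \<eta> * cot \<zeta>\<bar> * (1 - cos (\<theta> - \<phi>)) \<in> S"
        then have "k * \<bar>cot \<zeta>\<bar> \<in> S" by (simp add: k_def abs_mult mult_ac)
        then obtain s where s: "s \<in> S" "s = k * \<bar>cot \<zeta>\<bar>" by blast
        have "cot \<zeta> = tan (pi/2 - \<zeta>)" by (simp add: cot_def tan_def sin_diff cos_diff)
        then have "arctan (cot \<zeta>) = pi/2 - \<zeta>" using b by (simp add: arctan_tan)
        moreover have "arctan (s / k) = arctan (cot \<zeta>) \<or> arctan (s / k) = - arctan (cot \<zeta>)"
          using k s(2) by (auto simp: abs_if arctan_minus)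
        ultimately have "\<zeta> = pi/2 - arctan (s / k) \<or> \<zeta> = pi/2 + arctan (s / k)" by auto
        then show False using \<zeta>(2) s(1) by (auto simp: N_def)
      qed
    qed
    then have "(\<integral>\<^sup>+\<zeta>. indicator S (\<bar>cot \<eta> * cot \<zeta>\<bar> * (1 - cos (\<theta> - \<phi>))) \<partial>unif pi) = (\<integral>\<^sup>+\<zeta>. 0 \<partial>unif pi)"
      by (intro nn_integral_cong_AE) (auto elim!: eventually_mono)
    then show ?thesis by simp
  qed
  have \<phi>: "(\<integral>\<^sup>+\<phi>. \<integral>\<^sup>+\<zeta>. indicator S (\<bar>cot \<eta> * cot \<zeta>\<bar> * (1 - cos (\<theta> - \<phi>))) \<partial>unif pi \<partial>unif (2 * pi)) = 0"
    if nz: "cot \<eta> \<noteq> 0" for \<eta> \<theta> :: real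
  proof -
    have "AE \<phi> in unif (2 * pi). cos (\<theta> - \<phi>) \<noteq> 1"
    proof (rule AE_unif)
      show "countable (range (\<lambda>n::int. \<theta> - of_int n * 2 * pi))" by simp
      show "cos (\<theta> - \<phi>) \<noteq> 1" if "\<phi> \<notin> range (\<lambda>n::int. \<theta> - of_int n * 2 * pi)" for \<phi>
      proof
        assume "cos (\<theta> - \<phi>) = 1"
        then obtain n :: int where "\<theta> - \<phi> = of_int n * 2 * pi" by (auto simp: cos_one_2pi_int)
        then have "\<phi> = \<theta> - of_int n * 2 * pi" by simp
        then show False using that by blast
      qed
    qed
    then have "(\<integral>\<^sup>+\<phi>. \<integral>\<^sup>+\<zeta>. indicator S (\<bar>cot \<eta> * cot \<zeta>\<bar> * (1 - cos (\<theta> - \<phi>))) \<partial>unif pi \<partial>unif (2 * pi)) =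
        (\<integral>\<^sup>+\<phi>. 0 \<partial>unif (2 * pi))"
      by (intro nn_integral_cong_AE) (auto elim!: eventually_mono intro: \<zeta>[OF nz])
    then show ?thesis by simp
  qed
  have "(\<integral>\<^sup>+\<eta>. \<integral>\<^sup>+\<phi>. \<integral>\<^sup>+\<zeta>. indicator S (\<bar>cot \<eta> * cot \<zeta>\<bar> * (1 - cos (\<theta> - \<phi>)))
     \<partial>unif pi \<partial>unif (2 * pi) \<partial>unif pi) = 0" for \<theta>
  proof -
    have "AE \<eta> in unif pi. cot \<eta> \<noteq> 0"
    proof (rule AE_unif)
      show "countable {0, pi/2, pi}" by simp
      show "cot \<eta> \<noteq> 0" if "\<eta> \<in> {0..pi}" "\<eta> \<notin> {0, pi/2, pi}" for \<eta>
      proof -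
        have "cot \<eta> = tan (pi/2 - \<eta>)" by (simp add: cot_def tan_def sin_diff cos_diff)
        then have "arctan (cot \<eta>) = pi/2 - \<eta>" using that by (simp add: arctan_tan)
        then show ?thesis using that by auto
      qed
    qed
    then have "(\<integral>\<^sup>+\<eta>. \<integral>\<^sup>+\<phi>. \<integral>\<^sup>+\<zeta>. indicator S (\<bar>cot \<eta> * cot \<zeta>\<bar> * (1 - cos (\<theta> - \<phi>)))
       \<partial>unif pi \<partial>unif (2 * pi) \<partial>unif pi) = (\<integral>\<^sup>+\<eta>. 0 \<partial>unif pi)"
      by (intro nn_integral_cong_AE) (auto elim!: eventually_mono intro: \<phi>)
    then show ?thesis by simp
  qed
  then show ?thesis by simp
qed

theorem theorem3p6:
  fixes M :: "'w measure"
    and f g :: "'w \<Rightarrow> (complex ^ 2 ^ 2) set"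
  assumes "prob_space M"
    and "random_parabolic M f"
    and "random_parabolic M g"
    and "prob_space.indep_var M PSL2C_borel f PSL2C_borel g"
  shows "measure M {\<omega> \<in> space M. discrete_in_PSL2C (generate disc_group {f \<omega>, g \<omega>})}
           \<in> {0.314833 ..< 0.314834}"
proof -
  interpret prob_space M by fact
  define K where "K \<omega> = pair_invariant (coord (f \<omega>)) (coord (g \<omega>))" for \<omega>
  have K[measurable]: "K \<in> borel_measurable M"
    using measurable_compose[OF measurable_Pair[OF measurable_coord_random[OF assms(2)]
          measurable_coord_random[OF assms(3)]] measurable_pair_invariant]
    unfolding K_def[abs_def] by simp
  obtain \<theta> \<eta> where f: "uniform_rv M \<theta> 0 (2 * pi)" "uniform_rv M \<eta> 0 pi"
      "\<And>\<omega>. \<omega> \<in> space M \<Longrightarrow> f \<omega> = parabolic_elt (cot (\<eta> \<omega>)) (\<theta> \<omega>)"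
    using assms(2) by (auto simp: random_parabolic_def)
  obtain \<phi> \<zeta> where g: "uniform_rv M \<phi> 0 (2 * pi)" "uniform_rv M \<zeta> 0 pi"
      "\<And>\<omega>. \<omega> \<in> space M \<Longrightarrow> g \<omega> = parabolic_elt (cot (\<zeta> \<omega>)) (\<phi> \<omega>)"
    using assms(3) by (auto simp: random_parabolic_def)
  have [measurable]: "\<theta> \<in> borel_measurable M" "\<eta> \<in> borel_measurable M"
      "\<phi> \<in> borel_measurable M" "\<zeta> \<in> borel_measurable M"
    using distr_uniform_rv(1)[OF f(1)] distr_uniform_rv(1)[OF f(2)]
      distr_uniform_rv(1)[OF g(1)] distr_uniform_rv(1)[OF g(2)] by simp_all
  let ?D = "{\<omega> \<in> space M. discrete_in_PSL2C (generate disc_group {f \<omega>, g \<omega>})}"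
  have "{\<omega> \<in> space M. discrete_in_PSL2C (generate disc_group
      {parabolic_elt (cot (\<eta> \<omega>)) (\<theta> \<omega>), parabolic_elt (cot (\<zeta> \<omega>)) (\<phi> \<omega>)})} \<in> sets M"
    by (rule measurable_discrete) measurable
  also have "{\<omega> \<in> space M. discrete_in_PSL2C (generate disc_group
      {parabolic_elt (cot (\<eta> \<omega>)) (\<theta> \<omega>), parabolic_elt (cot (\<zeta> \<omega>)) (\<phi> \<omega>)})} = ?D"
    using f(3) g(3) by (auto cong: conj_cong)
  finally have D: "?D \<in> sets M" .
  \<comment> \<open>The value 0 stands for a common fixed point or a trivial generator, the other
    values for rotation angles that are rational multiples of pi. Off S the dichotomy at \<kappa> =
    2 is complete.\<close>
  define S where "S = insert 0 ((\<lambda>r. 1 - cos (pi * r)) ` \<rat>)"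
  have S: "countable S" by (simp add: S_def countable_rat)
  have "emeasure M {\<omega> \<in> space M. K \<omega> \<in> S} = 0"
    using emeasure_pair_invariant[OF assms, of S] nn_integral_pair_countable[OF S] S
    unfolding K_def by (simp add: sets.countable)
  moreover have "{\<omega> \<in> space M. K \<omega> \<in> S} \<in> sets M"
    using S by (intro measurable_sets_Collect[OF K]) (simp_all add: sets.countable)
  ultimately have "AE \<omega> in M. K \<omega> \<notin> S" by (intro AE_I[of _ _ "{\<omega> \<in> space M. K \<omega> \<in> S}"]) auto
  then have "AE \<omega> in M. \<omega> \<in> ?D \<longleftrightarrow> \<omega> \<in> {\<omega> \<in> space M. K \<omega> \<in> {2..}}"
  proof (rule AE_mp, intro AE_I2 impI)
    fix \<omega> assume \<omega>: "\<omega> \<in> space M" and KS: "K \<omega> \<notin> S"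
    have K_eq: "K \<omega> = \<bar>cot (\<eta> \<omega>) * cot (\<zeta> \<omega>)\<bar> * (1 - cos (\<theta> \<omega> - \<phi> \<omega>))"
      unfolding K_def f(3)[OF \<omega>] g(3)[OF \<omega>] coord_parabolic_elt pair_invariant_parabolic ..
    have "K \<omega> \<ge> 0" unfolding K_eq by simp
    then have "K \<omega> > 0" using KS by (auto simp: S_def less_le)
    moreover have "K \<omega> \<noteq> 1 - cos (pi * r)" if "r \<in> \<rat>" for r using KS that by (auto simp: S_def)
    ultimately have "discrete_in_PSL2C (generate disc_group {f \<omega>, g \<omega>}) \<longleftrightarrow> 2 \<le> K \<omega>"
      using discrete_if_large not_discrete_if_small
      unfolding K_eq f(3)[OF \<omega>] g(3)[OF \<omega>] by (metis not_le)
    then show "\<omega> \<in> ?D \<longleftrightarrow> \<omega> \<in> {\<omega> \<in> space M. K \<omega> \<in> {2..}}" using \<omega> by simp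
  qed
  then have "measure M ?D = measure M {\<omega> \<in> space M. K \<omega> \<in> {2..}}"
    by (rule finite_measure_eq_AE) (use D in measurable)
  also have "emeasure M {\<omega> \<in> space M. K \<omega> \<in> {2..}} = ennreal (4 * (arsinh 1)\<^sup>2 / pi\<^sup>2)"
    using emeasure_pair_invariant[OF assms, of "{2..}"] unfolding K_def nn_integral_pair_large by simp
  then have "measure M {\<omega> \<in> space M. K \<omega> \<in> {2..}} = 4 * (arsinh 1)\<^sup>2 / pi\<^sup>2"
    by (simp add: measure_def)
  finally show ?thesis using arsinh_1_over_pi_bounds by simp
qed

end
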